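(* Let $k\ge 2$ be an integer and let $\mu_k$ be the constant defined in the context. For each $n$ let $\mathbf v_0\in\mathbb S^{n-1}$, let $\mathbf X=\beta\,\mathbf v_0^{\otimes k}+\mathbf Z$ with $\mathbf Z\in\bigotimes^k\mathbb R^n$ a symmetric standard normal noise tensor, and let $\widehat{\mathbf v}^{\mathrm{ML}}$ be the maximum likelihood estimator, i.e. a maximizer of $\langle\mathbf X,\mathbf v^{\otimes k}\rangle$ over $\mathbf v\in\mathbb S^{n-1}$. Then for all $n$ large enough, and all $s>0$: if $\beta\ge\mu_k$, then $$\mathrm{Loss}(\widehat{\mathbf v}^{\mathrm{ML}},\mathbf v_0)\le\frac2\beta\,(\mu_k+s)$$ with probability at least $1-2e^{-ns^2/(16k)}$.
   Context: $\mathbb S^{n-1}$ is the unit sphere of $\mathbb R^n$; $\mathbf v^{\otimes k}\in\bigotimes^k\mathbb R^n$ has entries $\mathbf v_{i_1}\cdots\mathbf v_{i_k}$; $\langle\cdot,\cdot\rangle$ is the entrywise inner product of tensors. The symmetric standard normal noise tensor is $$\mathbf Z_{i_1,\dots,i_k}=\frac1{k!}\sqrt{\frac kn}\sum_{\pi\in\mathfrak S_k}\mathbf G_{i_{\pi(1)},\dots,i_{\pi(k)}},$$ with $\mathbf G\in\bigotimes^k\mathbb R^n$ having i.i.d. $\mathsf N(0,1)$ entries. For unit vectors, $\mathrm{Loss}(\widehat{\mathbf v},\mathbf v_0)=\min(\|\widehat{\mathbf v}-\mathbf v_0\|_2^2,\|\widehat{\mathbf v}+\mathbf v_0\|_2^2)=2-2|\langle\widehat{\mathbf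 v},\mathbf v_0\rangle|$. Definition of $\mu_k$: for $x\ge\eta_k:=2\sqrt{k-1}$ let $$g_k(x)=\frac12\Big\{\frac{2-k}{k}-\log\Big(\frac{kz^2}{2}\Big)+\frac{k-1}{2}z^2-\frac{2}{k^2z^2}\Big\},\qquad z=\frac{1}{(k-1)\sqrt{2k}}\Big(x-\sqrt{x^2-4(k-1)}\Big).$$ Then $\mu_k$ is the unique root of $g_k(x)=0$ in $[\eta_k,\infty)$. *)

theory Defs
  imports "HOL-Probability.Probability" "HOL-Combinatorics.Permutations"
begin

text \<open>
  Coordinates are indexed from 0. A vector of \<open>\<real>\<^sup>n\<close> is a function \<open>nat \<Rightarrow> real\<close> whose entries
  from \<open>n\<close> on vanish, the convention of \<open>nsphere\<close> in the library. A tensor of order \<open>k\<close> over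
  \<open>\<real>\<^sup>n\<close> is a function on multi-indices \<open>(i\<^sub>0, \<dots>, i\<^sub>k\<^sub>-\<^sub>1)\<close> of which only the values on
  \<open>multi_indices k n\<close> are ever used.
\<close>

definition inner_vec :: "nat \<Rightarrow> (nat \<Rightarrow> real) \<Rightarrow> (nat \<Rightarrow> real) \<Rightarrow> real" where
  "inner_vec n u v = (\<Sum>i<n. u i * v i)"

definition norm_vec :: "nat \<Rightarrow> (nat \<Rightarrow> real) \<Rightarrow> real" where
  "norm_vec n v = sqrt (inner_vec n v v)"

definition unit_sphere :: "nat \<Rightarrow> (nat \<Rightarrow> real) set" where
  "unit_sphere n = {v. (\<forall>i\<ge>n. v i = 0) \<and> norm_vec n v = 1}"

definition loss :: "nat \<Rightarrow> (nat \<Rightarrow> real) \<Rightarrow> (nat \<Rightarrow> real) \<Rightarrow> real" where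
  "loss n u v = min ((norm_vec n (\<lambda>i. u i - v i))\<^sup>2) ((norm_vec n (\<lambda>i. u i + v i))\<^sup>2)"

lemma norm_vec_squared: "(norm_vec n v)\<^sup>2 = inner_vec n v v"
  by (simp add: norm_vec_def inner_vec_def sum_nonneg)

lemma loss_eq:
  assumes "u \<in> unit_sphere n" "v \<in> unit_sphere n"
  shows "loss n u v = 2 - 2 * \<bar>inner_vec n u v\<bar>"
proof -
  have "inner_vec n u u = 1" "inner_vec n v v = 1"
    using assms by (auto simp: unit_sphere_def simp flip: norm_vec_squared)
  then have "(norm_vec n (\<lambda>i. u i - v i))\<^sup>2 = 2 - 2 * inner_vec n u v"
    and "(norm_vec n (\<lambda>i. u i + v i))\<^sup>2 = 2 + 2 * inner_vec n u v"
    unfolding norm_vec_squared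
    by (simp_all add: inner_vec_def algebra_simps sum.distrib sum_subtractf sum_distrib_left)
  then show ?thesis
    by (auto simp: loss_def min_def abs_if)
qed

definition multi_indices :: "nat \<Rightarrow> nat \<Rightarrow> (nat \<Rightarrow> nat) set" where
  "multi_indices k n = {..<k} \<rightarrow>\<^sub>E {..<n}"

definition inner_tensor ::
  "nat \<Rightarrow> nat \<Rightarrow> ((nat \<Rightarrow> nat) \<Rightarrow> real) \<Rightarrow> ((nat \<Rightarrow> nat) \<Rightarrow> real) \<Rightarrow> real" where
  "inner_tensor k n S T = (\<Sum>i\<in>multi_indices k n. S i * T i)"

definition tensor_power :: "nat \<Rightarrow> (nat \<Rightarrow> real) \<Rightarrow> (nat \<Rightarrow> nat) \<Rightarrow> real" where
  "tensor_power k v i = (\<Prod>j<k. v (i j))"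

definition iid_std_normal_tensor ::
  "'a measure \<Rightarrow> nat \<Rightarrow> nat \<Rightarrow> ('a \<Rightarrow> (nat \<Rightarrow> nat) \<Rightarrow> real) \<Rightarrow> bool" where
  "iid_std_normal_tensor M k n G \<longleftrightarrow>
     prob_space.indep_vars M (\<lambda>_. borel) (\<lambda>i \<omega>. G \<omega> i) (multi_indices k n) \<and>
     (\<forall>i\<in>multi_indices k n. distributed M lborel (\<lambda>\<omega>. G \<omega> i) std_normal_density)"

text \<open>Permutations of \<open>{..<k}\<close> act as the identity elsewhere, so \<open>i \<circ> \<pi>\<close> is again in
  \<open>multi_indices k n\<close>.\<close>

definition symmetric_noise ::
  "nat \<Rightarrow> nat \<Rightarrow> ((nat \<Rightarrow> nat) \<Rightarrow> real) \<Rightarrow> (nat \<Rightarrow> nat) \<Rightarrow> real" where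
  "symmetric_noise k n G i =
     1 / fact k * sqrt (real k / real n) * (\<Sum>\<pi> | \<pi> permutes {..<k}. G (i \<circ> \<pi>))"

definition spiked_tensor ::
  "nat \<Rightarrow> real \<Rightarrow> (nat \<Rightarrow> real) \<Rightarrow> ((nat \<Rightarrow> nat) \<Rightarrow> real) \<Rightarrow> (nat \<Rightarrow> nat) \<Rightarrow> real" where
  "spiked_tensor k \<beta> v\<^sub>0 Z i = \<beta> * tensor_power k v\<^sub>0 i + Z i"

definition is_ML_estimate ::
  "nat \<Rightarrow> nat \<Rightarrow> ((nat \<Rightarrow> nat) \<Rightarrow> real) \<Rightarrow> (nat \<Rightarrow> real) \<Rightarrow> bool" where
  "is_ML_estimate k n X v \<longleftrightarrow>
     is_arg_max (\<lambda>u. inner_tensor k n X (tensor_power k u)) (\<lambda>u. u \<in> unit_sphere n) v"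

definition eta :: "nat \<Rightarrow> real" where
  "eta k = 2 * sqrt (real k - 1)"

definition g_fun :: "nat \<Rightarrow> real \<Rightarrow> real" where
  "g_fun k x =
     (let z = 1 / ((real k - 1) * sqrt (2 * real k)) * (x - sqrt (x\<^sup>2 - 4 * (real k - 1)))
      in 1 / 2 * ((2 - real k) / real k - ln (real k * z\<^sup>2 / 2)
                  + (real k - 1) / 2 * z\<^sup>2 - 2 / ((real k)\<^sup>2 * z\<^sup>2)))"

definition mu :: "nat \<Rightarrow> real" where
  "mu k = (THE x. x \<ge> eta k \<and> g_fun k x = 0)"

end

theory Submission
  imports Defs "HOL-Real_Asymp.Real_Asymp"
begin

text \<open>
  Since the maximum likelihood estimator \<open>v\<close> beats \<open>v\<^sub>0\<close>, its loss is at most \<open>2 / \<beta>\<close> times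
  \<open>\<langle>Z, v\<^sup>k\<rangle> - \<langle>Z, v\<^sub>0\<^sup>k\<rangle>\<close>, and \<open>\<langle>Z, v\<^sup>k\<rangle> = sqrt (k / n) * \<langle>G, v\<^sup>k\<rangle>\<close>. So it suffices to show that the maximum of
  \<open>\<langle>Z, v\<^sup>k\<rangle>\<close> over the sphere exceeds \<open>mu k + s / 2\<close> only with Gaussian probability.

  By Bernoulli's inequality \<open>k * q \<le> q ^ k + k - 1\<close> for \<open>q \<ge> -1\<close>, so the process
  \<open>\<langle>G, v\<^sup>k\<rangle> + sqrt (k - 1) * \<xi>\<close> has the same variances as \<open>sqrt k * \<langle>g, v\<rangle>\<close> and larger covariances.
  Slepian's comparison for the exponential moment of the maximum then gives
  \<open>E exp (\<Lambda> * max) * exp (\<Lambda>\<^sup>2 * (k - 1) / 2) \<le> E exp (\<Lambda> * sqrt k * \<parallel>g\<parallel>)\<close>, and the right-hand side is bounded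
  by a Gaussian integral with a free parameter. This is the zero-temperature one-step
  replica-symmetry-breaking bound: \<open>mu k / sqrt k\<close> is exactly its minimum, and moving \<open>\<Lambda>\<close> away from the
  minimiser yields the Gaussian tail without a separate concentration inequality.

  Slepian's comparison itself is proved by replacing one process by the other in \<open>N\<close> increments of
  size \<open>1 / sqrt N\<close>: each replacement loses a factor \<open>1 + O (N powr (- 3 / 2))\<close>.
\<close>

section \<open>Gaussian heat semigroup\<close>

abbreviation std_gauss :: "real measure" where
  "std_gauss \<equiv> density lborel (\<lambda>x. ennreal (std_normal_density x))"

section \<open>One-dimensional Gaussian integrals\<close>

lemma prob_space_std_gauss: "prob_space std_gauss"
  using prob_space_normal_density[of 1 0] by simp

interpretation std_gauss: prob_space std_gauss
  by (rule prob_space_std_gauss)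

interpretation std_gauss_prod: product_prob_space "\<lambda>_. std_gauss" I for I :: "'i set"
  by (intro product_prob_spaceI prob_space_std_gauss)

text \<open>Completing the square: tilting the standard density by \<open>exp (c * y)\<close> moves
  its mean to \<open>c\<close> and leaves a constant factor.\<close>

lemma nn_integral_std_gauss_exp:
  "(\<integral>\<^sup>+ y. ennreal (exp (c * y)) \<partial>std_gauss) = ennreal (exp (c\<^sup>2 / 2))"
proof -
  have *: "std_normal_density y * exp (c * y) = exp (c\<^sup>2 / 2) * normal_density c 1 y" for y
  proof -
    have "- (y\<^sup>2) / 2 + c * y = c\<^sup>2 / 2 + - ((y - c)\<^sup>2) / 2"
      by (simp add: power2_eq_square field_simps)
    then have "exp (- (y\<^sup>2) / 2) * exp (c * y) = exp (c\<^sup>2 / 2) * exp (- ((y - c)\<^sup>2) / 2)"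
      by (simp only: flip: exp_add)
    then show ?thesis
      by (simp add: normal_density_def field_simps)
  qed
  have "(\<integral>\<^sup>+ y. ennreal (exp (c * y)) \<partial>std_gauss)
      = (\<integral>\<^sup>+ y. ennreal (exp (c\<^sup>2 / 2)) * ennreal (normal_density c 1 y) \<partial>lborel)"
    by (subst nn_integral_density) (simp_all add: * flip: ennreal_mult)
  also have "\<dots> = ennreal (exp (c\<^sup>2 / 2)) * (\<integral>\<^sup>+ y. ennreal (normal_density c 1 y) \<partial>lborel)"
    by (rule nn_integral_cmult) simp
  also have "(\<integral>\<^sup>+ y. ennreal (normal_density c 1 y) \<partial>lborel) = 1"
    using prob_space.emeasure_space_1[OF prob_space_normal_density[of 1 c]]
    by (simp add: emeasure_density)
  finally show ?thesis by simp
qed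

text \<open>The tilted density is \<open>\<sigma>\<close> times a centred normal density of variance
  \<open>1 / (1 - 2 * \<tau>)\<close>, which is meaningful exactly for
  \<open>\<tau> < 1 / 2\<close>.\<close>

lemma nn_integral_std_gauss_exp_square:
  assumes "\<tau> < 1 / 2"
  shows "(\<integral>\<^sup>+ y. ennreal (exp (\<tau> * y\<^sup>2)) \<partial>std_gauss) = ennreal ((1 - 2 * \<tau>) powr (- 1 / 2))"
proof -
  define \<sigma> where "\<sigma> = 1 / sqrt (1 - 2 * \<tau>)"
  have \<sigma>: "\<sigma> > 0" "\<sigma>\<^sup>2 = 1 / (1 - 2 * \<tau>)"
    using assms by (simp_all add: \<sigma>_def power_divide)
  have *: "std_normal_density y * exp (\<tau> * y\<^sup>2) = \<sigma> * normal_density 0 \<sigma> y" for y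
  proof -
    have "- (y\<^sup>2) / 2 + \<tau> * y\<^sup>2 = - (y\<^sup>2) / (2 * \<sigma>\<^sup>2)"
      using assms by (simp add: \<sigma>(2) field_simps)
    then have "exp (- (y\<^sup>2) / 2) * exp (\<tau> * y\<^sup>2) = exp (- (y\<^sup>2) / (2 * \<sigma>\<^sup>2))"
      by (simp only: flip: exp_add)
    moreover have "sqrt (2 * pi * \<sigma>\<^sup>2) = sqrt (2 * pi) * \<sigma>"
      using \<sigma>(1) by (simp add: real_sqrt_mult)
    ultimately show ?thesis
      using \<sigma>(1) by (simp add: normal_density_def field_simps)
  qed
  have "(\<integral>\<^sup>+ y. ennreal (exp (\<tau> * y\<^sup>2)) \<partial>std_gauss)
      = (\<integral>\<^sup>+ y. ennreal \<sigma> * ennreal (normal_density 0 \<sigma> y) \<partial>lborel)"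
    using \<sigma>(1) by (subst nn_integral_density) (simp_all add: * flip: ennreal_mult)
  also have "\<dots> = ennreal \<sigma> * (\<integral>\<^sup>+ y. ennreal (normal_density 0 \<sigma> y) \<partial>lborel)"
    by (rule nn_integral_cmult) simp
  also have "(\<integral>\<^sup>+ y. ennreal (normal_density 0 \<sigma> y) \<partial>lborel) = 1"
    using prob_space.emeasure_space_1[OF prob_space_normal_density[of \<sigma> 0]] \<sigma>(1)
    by (simp add: emeasure_density)
  also have "\<sigma> = (1 - 2 * \<tau>) powr (- (1 / 2))"
    unfolding \<sigma>_def using assms by (subst powr_minus_divide) (simp add: powr_half_sqrt)
  finally show ?thesis by simp
qed

text \<open>Variances of independent centred Gaussians add, by convolution of normal densities. This
  is the scalar case of the semigroup law below.\<close>

lemma nn_integral_std_gauss_add: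
  assumes [measurable]: "f \<in> borel_measurable borel" and "s > 0" "t > 0"
  shows "(\<integral>\<^sup>+ x. \<integral>\<^sup>+ y. f (s * x + t * y) \<partial>std_gauss \<partial>std_gauss)
    = (\<integral>\<^sup>+ x. f (sqrt (s\<^sup>2 + t\<^sup>2) * x) \<partial>std_gauss)"
proof -
  have scale: "density lborel (normal_density 0 r) = distr std_gauss borel (\<lambda>x. r * x)"
    if "r > 0" for r :: real
  proof -
    have "distributed std_gauss lborel (\<lambda>x. x) std_normal_density"
      by (simp add: distributed_def distr_id2 )
    from std_gauss.normal_density_affine[OF this, of r 0] that
    have "distributed std_gauss lborel (\<lambda>x. r * x) (normal_density 0 r)" by simp
    then show ?thesis
      using distr_cong[OF refl sets_lborel refl, of std_gauss "\<lambda>x. r * x"] by (simp add: distributed_def)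
  qed
  have fin: "finite_measure (density lborel (normal_density 0 r))" if "r > 0" for r
    using prob_space_normal_density[OF that] by (simp add: prob_space_def)
  have "(\<integral>\<^sup>+ x. \<integral>\<^sup>+ y. f (s * x + t * y) \<partial>std_gauss \<partial>std_gauss)
      = (\<integral>\<^sup>+ x. \<integral>\<^sup>+ y. f (x + y) \<partial>density lborel (normal_density 0 t) \<partial>density lborel (normal_density 0 s))"
    by (simp add: scale[OF assms(2)] scale[OF assms(3)] nn_integral_distr)
  also have "\<dots> = (\<integral>\<^sup>+ x. f x \<partial>(density lborel (normal_density 0 s) \<star> density lborel (normal_density 0 t)))"
    using assms(2,3) by (intro nn_integral_convolution[symmetric] fin) simp_all
  also have "density lborel (normal_density 0 s) \<star> density lborel (normal_density 0 t)
      = density lborel (normal_density 0 (sqrt (s\<^sup>2 + t\<^sup>2)))"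
    using assms(2,3) conv_normal_density_zero_mean[of s t]
    by (subst convolution_density) (simp_all add: fin ennreal_mult)
  also have "(\<integral>\<^sup>+ x. f x \<partial>\<dots>) = (\<integral>\<^sup>+ x. f (sqrt (s\<^sup>2 + t\<^sup>2) * x) \<partial>std_gauss)"
    using assms(2,3) by (subst scale) (simp_all add: nn_integral_distr sum_power2_gt_zero_iff)
  finally show ?thesis .
qed

section \<open>Finite products of standard Gaussians and the operators they induce\<close>

abbreviation std_gauss_PiM :: "'i set \<Rightarrow> ('i \<Rightarrow> real) measure" where
  "std_gauss_PiM I \<equiv> PiM I (\<lambda>_. std_gauss)"

lemma nn_integral_std_gauss_PiM_exp:
  assumes "finite I"
  shows "(\<integral>\<^sup>+ y. ennreal (exp (\<Sum>i\<in>I. c i * y i)) \<partial>std_gauss_PiM I)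
    = ennreal (exp ((\<Sum>i\<in>I. (c i)\<^sup>2) / 2))"
proof -
  have "(\<integral>\<^sup>+ y. ennreal (exp (\<Sum>i\<in>I. c i * y i)) \<partial>std_gauss_PiM I)
      = (\<integral>\<^sup>+ y. (\<Prod>i\<in>I. ennreal (exp (c i * y i))) \<partial>std_gauss_PiM I)"
    using assms by (simp add: exp_sum prod_ennreal)
  also have "\<dots> = (\<Prod>i\<in>I. ennreal (exp ((c i)\<^sup>2 / 2)))"
    using assms by (subst std_gauss_prod.product_nn_integral_prod) (simp_all add: nn_integral_std_gauss_exp)
  also have "\<dots> = ennreal (exp ((\<Sum>i\<in>I. (c i)\<^sup>2) / 2))"
    using assms by (simp add: prod_ennreal exp_sum sum_divide_distrib)
  finally show ?thesis .
qed

lemma nn_integral_std_gauss_PiM_exp_square: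
  assumes "finite I" "\<tau> < 1 / 2"
  shows "(\<integral>\<^sup>+ y. ennreal (exp (\<tau> * (\<Sum>i\<in>I. (y i)\<^sup>2))) \<partial>std_gauss_PiM I)
    = ennreal ((1 - 2 * \<tau>) powr (- real (card I) / 2))"
proof -
  have "(\<integral>\<^sup>+ y. ennreal (exp (\<tau> * (\<Sum>i\<in>I. (y i)\<^sup>2))) \<partial>std_gauss_PiM I)
      = (\<integral>\<^sup>+ y. (\<Prod>i\<in>I. ennreal (exp (\<tau> * (y i)\<^sup>2))) \<partial>std_gauss_PiM I)"
    using assms by (simp add: exp_sum prod_ennreal sum_distrib_left)
  also have "\<dots> = ennreal ((1 - 2 * \<tau>) powr (- 1 / 2)) ^ card I"
    using assms by (subst std_gauss_prod.product_nn_integral_prod)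
      (simp_all add: nn_integral_std_gauss_exp_square)
  also have "\<dots> = ennreal ((1 - 2 * \<tau>) powr (- real (card I) / 2))"
    using assms by (simp add: ennreal_power powr_power)
  finally show ?thesis .
qed

text \<open>The heat semigroup of the Gaussian process \<open>l \<mapsto> (\<Sum>i\<in>I. y i * w i l)\<close>, at time \<open>\<sigma>\<^sup>2\<close>.\<close>

definition gauss_op ::
  "'i set \<Rightarrow> ('i \<Rightarrow> nat \<Rightarrow> real) \<Rightarrow> real \<Rightarrow> ((nat \<Rightarrow> real) \<Rightarrow> ennreal) \<Rightarrow> (nat \<Rightarrow> real) \<Rightarrow> ennreal" where
  "gauss_op I w \<sigma> F x = (\<integral>\<^sup>+ y. F (\<lambda>l. x l + \<sigma> * (\<Sum>i\<in>I. y i * w i l)) \<partial>std_gauss_PiM I)"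

text \<open>The Borel sets of \<open>nat \<Rightarrow> real\<close> come from the product topology
  over a countable index set, so measurability can be checked coordinate by coordinate.\<close>

lemma measurable_gauss_shift [measurable]:
  fixes w :: "'i \<Rightarrow> nat \<Rightarrow> real"
  assumes "finite I"
  shows "(\<lambda>(x, y). \<lambda>l. x l + \<sigma> * (\<Sum>i\<in>I. y i * w i l))
    \<in> borel \<Otimes>\<^sub>M std_gauss_PiM I \<rightarrow>\<^sub>M (borel :: (nat \<Rightarrow> real) measure)"
  unfolding case_prod_beta
proof (rule measurable_coordinatewise_then_product)
  fix l
  have "(\<lambda>x :: nat \<Rightarrow> real. x l) \<in> borel_measurable borel"
    by (rule measurable_product_coordinates)
  moreover have "(\<lambda>y. y i) \<in> borel_measurable (std_gauss_PiM I)" if "i \<in> I" for i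
    using measurable_component_singleton[OF that, of "\<lambda>_. std_gauss"] by simp
  ultimately show "(\<lambda>z. fst z l + \<sigma> * (\<Sum>i\<in>I. snd z i * w i l))
      \<in> borel_measurable (borel \<Otimes>\<^sub>M std_gauss_PiM I)"
    by measurable
qed

lemma measurable_gauss_op [measurable]:
  assumes "finite I" and [measurable]: "F \<in> borel_measurable borel"
  shows "gauss_op I w \<sigma> F \<in> borel_measurable borel"
proof -
  have "(\<lambda>z. F (case z of (x, y) \<Rightarrow> \<lambda>l. x l + \<sigma> * (\<Sum>i\<in>I. y i * w i l)))
      \<in> borel_measurable (borel \<Otimes>\<^sub>M std_gauss_PiM I)"
    using measurable_compose[OF measurable_gauss_shift[OF assms(1)] assms(2)] .
  then show ?thesis
    unfolding gauss_op_def by (intro sigma_finite_measure.borel_measurable_nn_integral prob_space_imp_sigma_finite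
        prob_space_PiM prob_space_std_gauss) (simp add: case_prod_beta')
qed

lemma measurable_gauss_shift1:
  fixes w :: "'i \<Rightarrow> nat \<Rightarrow> real"
  assumes "finite I" 
  shows "(\<lambda>y. \<lambda>l. x l + \<sigma> * (\<Sum>i\<in>I. y i * w i l)) \<in> std_gauss_PiM I \<rightarrow>\<^sub>M (borel :: (nat \<Rightarrow> real) measure)"
  using measurable_compose[OF measurable_Pair1' measurable_gauss_shift[OF assms, of \<sigma> w], of x]
  by simp

lemma gauss_op_mono: "(\<And>x. F x \<le> F' x) \<Longrightarrow> gauss_op I w \<sigma> F x \<le> gauss_op I w \<sigma> F' x"
  unfolding gauss_op_def by (intro nn_integral_mono) simp

lemma gauss_op_cmult:
  assumes "finite I" and [measurable]: "F \<in> borel_measurable borel"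
  shows "gauss_op I w \<sigma> (\<lambda>x. c * F x) x = c * gauss_op I w \<sigma> F x"
  unfolding gauss_op_def
  by (intro nn_integral_cmult measurable_compose[OF measurable_gauss_shift1 assms(2)] assms)

text \<open>Both sides average \<open>F\<close> over the same two independent shifts, so this is
  Tonelli's theorem. It later allows increments of the two processes to be interchanged.\<close>

lemma gauss_op_commute:
  assumes "finite I" "finite J" and [measurable]: "F \<in> borel_measurable borel"
  shows "gauss_op I w \<sigma> (gauss_op J w' \<tau> F) x = gauss_op J w' \<tau> (gauss_op I w \<sigma> F) x"
proof -
  interpret I: finite_product_sigma_finite "\<lambda>_. std_gauss" I
    by standard fact
  interpret J: finite_product_sigma_finite "\<lambda>_. std_gauss" J
    by standard fact
  interpret pair_sigma_finite "std_gauss_PiM I" "std_gauss_PiM J" ..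
  have "(\<lambda>z. (\<lambda>l. x l + \<sigma> * (\<Sum>i\<in>I. fst z i * w i l), snd z))
      \<in> std_gauss_PiM I \<Otimes>\<^sub>M std_gauss_PiM J \<rightarrow>\<^sub>M borel \<Otimes>\<^sub>M std_gauss_PiM J"
    by (intro measurable_Pair measurable_snd measurable_compose[OF measurable_fst measurable_gauss_shift1] assms)
  from measurable_compose[OF measurable_compose[OF this measurable_gauss_shift[OF assms(2)]] assms(3)]
  have "(\<lambda>z. F (\<lambda>l. x l + \<sigma> * (\<Sum>i\<in>I. fst z i * w i l) + \<tau> * (\<Sum>i\<in>J. snd z i * w' i l)))
      \<in> borel_measurable (std_gauss_PiM I \<Otimes>\<^sub>M std_gauss_PiM J)"
    by (simp only: prod.case)
  then have [measurable]:
    "(\<lambda>(y, y'). F (\<lambda>l. x l + \<sigma> * (\<Sum>i\<in>I. y i * w i l) + \<tau> * (\<Sum>i\<in>J. y' i * w' i l)))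
      \<in> borel_measurable (std_gauss_PiM I \<Otimes>\<^sub>M std_gauss_PiM J)"
    by (simp only: case_prod_beta')
  have "gauss_op I w \<sigma> (gauss_op J w' \<tau> F) x
      = (\<integral>\<^sup>+ y'. \<integral>\<^sup>+ y. F (\<lambda>l. x l + \<sigma> * (\<Sum>i\<in>I. y i * w i l) + \<tau> * (\<Sum>i\<in>J. y' i * w' i l))
          \<partial>std_gauss_PiM I \<partial>std_gauss_PiM J)"
    unfolding gauss_op_def by (rule Fubini'[symmetric]) measurable
  then show ?thesis
    by (simp add: gauss_op_def add_ac)
qed

lemma gauss_op_singleton:
  assumes [measurable]: "F \<in> borel_measurable borel"
  shows "gauss_op {i} w \<sigma> F x = (\<integral>\<^sup>+ t. F (\<lambda>l. x l + \<sigma> * (t * w i l)) \<partial>std_gauss)"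
proof -
  have "(\<lambda>t. \<lambda>l. x l + \<sigma> * (t * w i l)) \<in> std_gauss \<rightarrow>\<^sub>M (borel :: (nat \<Rightarrow> real) measure)"
    by (rule measurable_coordinatewise_then_product) simp
  from std_gauss_prod.product_nn_integral_singleton[OF measurable_compose[OF this assms], of i]
  show ?thesis by (simp add: gauss_op_def)
qed

text \<open>Tonelli splits off one Gaussian coordinate, which makes induction over the index set
  possible.\<close>

lemma gauss_op_insert:
  assumes "finite I" "i \<notin> I" and [measurable]: "F \<in> borel_measurable borel"
  shows "gauss_op (insert i I) w \<sigma> F x = gauss_op {i} w \<sigma> (gauss_op I w \<sigma> F) x"
proof -
  have "(\<lambda>y. F (\<lambda>l. x l + \<sigma> * (\<Sum>i\<in>insert i I. y i * w i l))) \<in> borel_measurable (std_gauss_PiM (insert i I))"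
    using assms by (intro measurable_compose[OF measurable_gauss_shift1 assms(3)]) simp
  from std_gauss_prod.product_nn_integral_insert_rev[OF assms(1,2) this]
  have "gauss_op (insert i I) w \<sigma> F x
      = (\<integral>\<^sup>+ t. \<integral>\<^sup>+ y. F (\<lambda>l. x l + \<sigma> * (\<Sum>j\<in>insert i I. (y(i := t)) j * w j l)) \<partial>std_gauss_PiM I \<partial>std_gauss)"
    by (simp add: gauss_op_def)
  also have "\<dots> = (\<integral>\<^sup>+ t. gauss_op I w \<sigma> F (\<lambda>l. x l + \<sigma> * (t * w i l)) \<partial>std_gauss)"
  proof -
    have "(\<Sum>j\<in>insert i I. (y(i := t)) j * w j l) = t * w i l + (\<Sum>j\<in>I. y j * w j l)" for y t l
      using assms by (auto intro!: sum.cong)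
    then show ?thesis
      by (simp add: gauss_op_def algebra_simps)
  qed
  also have "\<dots> = gauss_op {i} w \<sigma> (gauss_op I w \<sigma> F) x"
    using assms by (simp add: gauss_op_singleton measurable_gauss_op)
  finally show ?thesis .
qed

text \<open>Since \<open>\<sigma>\<close> is a standard deviation, times add as squares. In the
  induction the operator of the new coordinate commutes past that of the old ones, so the scalar law
  and the induction hypothesis apply separately.\<close>

lemma gauss_op_semigroup:
  assumes "finite I" and "F \<in> borel_measurable borel" "\<sigma> > 0" "\<tau> > 0"
  shows "gauss_op I w \<sigma> (gauss_op I w \<tau> F) x = gauss_op I w (sqrt (\<sigma>\<^sup>2 + \<tau>\<^sup>2)) F x"
  using assms(1,2)
proof (induction I arbitrary: x F)
  case empty
  then show ?case by (simp add: gauss_op_def PiM_empty)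
next
  case (insert i I)
  have single: "gauss_op {i} w \<sigma> (gauss_op {i} w \<tau> F) x = gauss_op {i} w (sqrt (\<sigma>\<^sup>2 + \<tau>\<^sup>2)) F x"
    if [measurable]: "F \<in> borel_measurable borel" for F x
  proof -
    have m: "(\<lambda>t. \<lambda>l. x l + t * w i l) \<in> borel \<rightarrow>\<^sub>M (borel :: (nat \<Rightarrow> real) measure)"
      by (rule measurable_coordinatewise_then_product) simp
    have "gauss_op {i} w \<sigma> (gauss_op {i} w \<tau> F) x
        = (\<integral>\<^sup>+ s. \<integral>\<^sup>+ t. F (\<lambda>l. x l + (\<sigma> * s + \<tau> * t) * w i l) \<partial>std_gauss \<partial>std_gauss)"
      by (simp add: gauss_op_singleton measurable_gauss_op distrib_right mult.assoc add.assoc)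
    also have "\<dots> = (\<integral>\<^sup>+ t. F (\<lambda>l. x l + (sqrt (\<sigma>\<^sup>2 + \<tau>\<^sup>2) * t) * w i l) \<partial>std_gauss)"
      by (rule nn_integral_std_gauss_add[OF measurable_compose[OF m that] assms(3,4)])
    also have "\<dots> = gauss_op {i} w (sqrt (\<sigma>\<^sup>2 + \<tau>\<^sup>2)) F x"
      by (simp add: gauss_op_singleton mult.assoc)
    finally show ?thesis .
  qed
  have ins: "gauss_op (insert i I) w r F = gauss_op {i} w r (gauss_op I w r F)"
    if "F \<in> borel_measurable borel" for r F
    using insert.hyps that by (intro ext gauss_op_insert)
  have com: "gauss_op I w \<sigma> (gauss_op {i} w \<tau> F) = gauss_op {i} w \<tau> (gauss_op I w \<sigma> F)"
    if "F \<in> borel_measurable borel" for F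
    using insert.hyps that by (intro ext gauss_op_commute) auto
  have IH: "gauss_op I w \<sigma> (gauss_op I w \<tau> F) = gauss_op I w (sqrt (\<sigma>\<^sup>2 + \<tau>\<^sup>2)) F"
    using insert by (intro ext) auto
  have "finite (insert i I)" "finite {i}" using insert by auto
  note meas = measurable_gauss_op[OF this(1) \<open>F \<in> borel_measurable borel\<close>]
    measurable_gauss_op[OF this(2)] measurable_gauss_op[OF \<open>finite I\<close>]
  have "gauss_op (insert i I) w \<sigma> (gauss_op (insert i I) w \<tau> F) x
      = gauss_op {i} w \<sigma> (gauss_op I w \<sigma> (gauss_op {i} w \<tau> (gauss_op I w \<tau> F))) x"
    by (simp only: ins[OF meas(1)]) (simp only: ins[OF \<open>F \<in> borel_measurable borel\<close>])
  also have "\<dots> = gauss_op {i} w \<sigma> (gauss_op {i} w \<tau> (gauss_op I w \<sigma> (gauss_op I w \<tau> F))) x"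
    by (simp only: com[OF meas(3)[OF \<open>F \<in> borel_measurable borel\<close>]])
  also have "\<dots> = gauss_op (insert i I) w (sqrt (\<sigma>\<^sup>2 + \<tau>\<^sup>2)) F x"
    by (simp only: IH single[OF meas(3)[OF \<open>F \<in> borel_measurable borel\<close>]]
        ins[OF \<open>F \<in> borel_measurable borel\<close>])
  finally show ?case .
qed

section \<open>Slepian comparison\<close>

text \<open>For \<open>y \<ge> 1 / 2\<close> this is Taylor's theorem at 1 with a bounded third
  derivative. For \<open>y < 1 / 2\<close> the power and the quadratic both lie in the unit
  interval, while the right-hand side is at least \<open>8 * (1 / 2) ^ 3 = 1\<close>.\<close>

lemma powr_second_order:
  fixes a y :: real
  assumes "0 < a" "a < 1" "y > 0"
  shows "\<bar>y powr a - (1 + a * (y - 1) - a * (1 - a) / 2 * (y - 1)\<^sup>2)\<bar> \<le> 8 * \<bar>y - 1\<bar> ^ 3"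
proof (cases "y < 1 / 2")
  case True
  have "y powr a \<le> 1" using assms True by (simp add: powr_le1)
  moreover have "0 \<le> y powr a" by simp
  moreover have "1 + a * (y - 1) - a * (1 - a) / 2 * (y - 1)\<^sup>2 \<le> 1"
  proof -
    have "a * (y - 1) \<le> 0" using assms True by (simp add: mult_le_0_iff)
    moreover have "0 \<le> a * (1 - a) / 2 * (y - 1)\<^sup>2" using assms by simp
    ultimately show ?thesis by linarith
  qed
  moreover have "0 \<le> 1 + a * (y - 1) - a * (1 - a) / 2 * (y - 1)\<^sup>2"
  proof -
    have "(y - 1)\<^sup>2 \<le> 1" using assms True by (simp add: power_le_one_iff abs_square_le_1)
    then have "a * (1 - a) / 2 * (y - 1)\<^sup>2 \<le> a * (1 - a) / 2"
      using assms by (intro mult_left_le) auto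
    moreover have "a * (y - 1) \<ge> - a" using assms by (simp add: algebra_simps)
    moreover have "1 - a - a * (1 - a) / 2 = (1 - a) * (1 - a / 2)" by (simp add: field_simps)
    moreover have "(1 - a) * (1 - a / 2) \<ge> 0" using assms by simp
    ultimately show ?thesis by linarith
  qed
  moreover have "8 * \<bar>y - 1\<bar> ^ 3 \<ge> 1"
  proof -
    have "(1 / 2) ^ 3 \<le> \<bar>y - 1\<bar> ^ 3" using True by (intro power_mono) auto
    then show ?thesis by (simp add: power_divide)
  qed
  ultimately show ?thesis by linarith
next
  case False
  show ?thesis
  proof (cases "y = 1")
    case neq: False
    \<comment> \<open>The \<open>m\<close>-th derivative of \<open>t powr a\<close>.\<close>
    define f where "f m t = (\<Prod>j<m. a - real j) * t powr (a - real m)" for m :: nat and t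
    have "\<exists>t. (if y < 1 then y < t \<and> t < 1 else 1 < t \<and> t < y) \<and>
        y powr a = (\<Sum>m<3. f m 1 / fact m * (y - 1) ^ m) + f 3 t / fact 3 * (y - 1) ^ 3"
    proof (rule Taylor[of 3 f "\<lambda>t. t powr a" "min y 1" "max y 1" 1 y])
      show "\<forall>(m::nat) t. m < 3 \<and> min y 1 \<le> t \<and> t \<le> max y 1 \<longrightarrow> DERIV (f m) t :> f (Suc m) t"
      proof (intro allI impI)
        fix m :: nat and t assume "m < 3 \<and> min y 1 \<le> t \<and> t \<le> max y 1"
        then have "t > 0" using assms by auto
        then show "DERIV (f m) t :> f (Suc m) t"
          unfolding f_def
          by (auto intro!: derivative_eq_intros simp: field_simps powr_diff powr_add power_Suc)
      qed
    qed (use neq in \<open>auto simp: f_def\<close>)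
    then obtain t where t': "if y < 1 then y < t \<and> t < 1 else 1 < t \<and> t < y" and
      eq: "y powr a = (\<Sum>m<3. f m 1 / fact m * (y - 1) ^ m) + f 3 t / fact 3 * (y - 1) ^ 3"
      by blast
    from t' have t: "t \<ge> 1 / 2"
      using False by (auto split: if_splits)
    have "(\<Sum>m<3. f m 1 / fact m * (y - 1) ^ m) = 1 + a * (y - 1) - a * (1 - a) / 2 * (y - 1)\<^sup>2"
      by (simp add: f_def eval_nat_numeral lessThan_Suc field_simps)
    with eq have "y powr a - (1 + a * (y - 1) - a * (1 - a) / 2 * (y - 1)\<^sup>2) = f 3 t / 6 * (y - 1) ^ 3"
      by (simp add: eval_nat_numeral)
    \<comment> \<open>The remainder carries the factor \<open>1 / fact 3\<close>, so the bound 48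
      yields the constant 8.\<close>
    moreover have "\<bar>f 3 t\<bar> \<le> 48"
    proof -
      have "t powr (a - 3) \<le> (1 / 2) powr (a - 3)"
        using t assms by (intro powr_mono2') auto
      also have "\<dots> = 2 powr (3 - a)" 
          using powr_minus_divide[of "2::real" "a - 3"] by (simp add: powr_divide)
      also have "\<dots> \<le> 2 powr 3" using assms by (intro powr_mono) auto
      finally have "t powr (a - 3) \<le> 8" by simp
      moreover have "\<bar>f 3 t\<bar> = (a * (1 - a) * (2 - a)) * t powr (a - 3)"
        using assms by (simp add: f_def eval_nat_numeral lessThan_Suc abs_mult)
      moreover have "a * (1 - a) * (2 - a) \<le> 1 * 1 * 2" 
        using assms by (intro mult_mono) auto
      moreover have "0 \<le> a * (1 - a) * (2 - a)" using assms by simp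
      ultimately have "\<bar>f 3 t\<bar> \<le> 2 * 8"
        using mult_mono[of "a * (1 - a) * (2 - a)" 2 "t powr (a - 3)" 8] by simp
      then show ?thesis by simp
    qed
    ultimately show ?thesis
      using mult_right_mono[of "\<bar>f 3 t\<bar>" 48 "\<bar>y - 1\<bar> ^ 3"]
      by (simp only: abs_mult power_abs abs_divide) simp
  qed simp
qed

text \<open>Separates the cubic smallness in \<open>\<epsilon>\<close> from a dominating function of
  \<open>x\<close> whose Gaussian expectation is explicit.\<close>

lemma abs_exp_minus_one_cube_le:
  fixes x \<epsilon> :: real
  assumes "0 \<le> \<epsilon>" "\<epsilon> \<le> 1"
  shows "\<bar>exp (\<epsilon> * x) - 1\<bar> ^ 3 \<le> 6 * \<epsilon> ^ 3 * (exp (4 * x) + exp (- 4 * x))"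
proof -
  have *: "\<bar>exp t - 1\<bar> \<le> \<bar>t\<bar> * exp \<bar>t\<bar>" for t :: real
  proof (cases "t \<ge> 0")
    case True
    have "exp t * exp (- t) \<ge> exp t * (1 - t)"
      using exp_ge_add_one_self[of "- t"] by (intro mult_left_mono) auto
    then show ?thesis using True by (simp add: algebra_simps flip: exp_add)
  next
    case False
    have "1 - exp t \<le> - t" using exp_ge_add_one_self[of t] by linarith
    also have "\<dots> \<le> - t * exp (- t)"
      using False by simp
    finally show ?thesis using False by simp
  qed
  have "\<bar>x\<bar> ^ 3 \<le> 6 * exp \<bar>x\<bar>"
  proof -
    \<comment> \<open>One term of the exponential series is at most the whole series.\<close>
    have "\<bar>x\<bar> ^ 3 /\<^sub>R fact 3 \<le> (\<Sum>n. \<bar>x\<bar> ^ n /\<^sub>R fact n)"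
      using sum_le_suminf[OF summable_exp_generic[of "\<bar>x\<bar>"], of "{3}"] by simp
    then show ?thesis by (simp add: exp_def eval_nat_numeral)
  qed
  then have x3: "\<bar>x\<bar> ^ 3 * exp (3 * \<bar>x\<bar>) \<le> 6 * exp (4 * \<bar>x\<bar>)"
  proof -
    have "\<bar>x\<bar> ^ 3 * exp (3 * \<bar>x\<bar>) \<le> 6 * exp \<bar>x\<bar> * exp (3 * \<bar>x\<bar>)"
      using \<open>\<bar>x\<bar> ^ 3 \<le> 6 * exp \<bar>x\<bar>\<close> by (rule mult_right_mono) simp
    then show ?thesis by (simp add: mult.assoc flip: exp_add)
  qed
  have "\<bar>exp (\<epsilon> * x) - 1\<bar> \<le> (\<epsilon> * \<bar>x\<bar>) * exp (\<epsilon> * \<bar>x\<bar>)"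
    using *[of "\<epsilon> * x"] assms by (simp add: abs_mult)
  also have "\<dots> \<le> (\<epsilon> * \<bar>x\<bar>) * exp \<bar>x\<bar>"
    using assms by (intro mult_left_mono) (auto simp: mult_left_le_one_le)
  finally have "\<bar>exp (\<epsilon> * x) - 1\<bar> ^ 3 \<le> ((\<epsilon> * \<bar>x\<bar>) * exp \<bar>x\<bar>) ^ 3"
    by (rule power_mono) simp
  also have "\<dots> = \<epsilon> ^ 3 * (\<bar>x\<bar> ^ 3 * exp (3 * \<bar>x\<bar>))"
    by (simp add: power_mult_distrib exp_of_nat_mult[symmetric])
  also have "\<dots> \<le> \<epsilon> ^ 3 * (6 * exp (4 * \<bar>x\<bar>))"
    using x3 assms by (intro mult_left_mono) auto
  also have "\<dots> \<le> \<epsilon> ^ 3 * (6 * (exp (4 * x) + exp (- 4 * x)))"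
    using assms by (intro mult_left_mono) (auto simp: abs_if)
  finally show ?thesis by (simp only: mult_ac)
qed

lemma integrable_std_gauss_PiM_exp:
  assumes "finite I"
  shows "integrable (std_gauss_PiM I) (\<lambda>y. exp (\<Sum>i\<in>I. c i * y i))"
    and "(\<integral>y. exp (\<Sum>i\<in>I. c i * y i) \<partial>std_gauss_PiM I) = exp ((\<Sum>i\<in>I. (c i)\<^sup>2) / 2)"
proof -
  have [measurable]: "(\<lambda>y. exp (\<Sum>i\<in>I. c i * y i)) \<in> borel_measurable (std_gauss_PiM I)"
    by measurable
  show "integrable (std_gauss_PiM I) (\<lambda>y. exp (\<Sum>i\<in>I. c i * y i))"
    and "(\<integral>y. exp (\<Sum>i\<in>I. c i * y i) \<partial>std_gauss_PiM I) = exp ((\<Sum>i\<in>I. (c i)\<^sup>2) / 2)"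
    using nn_integral_eq_integrable[of "\<lambda>y. exp (\<Sum>i\<in>I. c i * y i)" "std_gauss_PiM I"
        "exp ((\<Sum>i\<in>I. (c i)\<^sup>2) / 2)"] nn_integral_std_gauss_PiM_exp[OF assms, of c]
    by simp_all
qed

text \<open>The first two moments of \<open>\<Sum>u. p u * exp (\<epsilon> * b * A u)\<close> are explicit, so replacing \<open>Y powr a\<close>
  by its second-order expansion at \<open>1\<close> leaves only an error of third order in \<open>\<epsilon>\<close>.\<close>

lemma gauss_small_step:
  fixes w :: "'i \<Rightarrow> nat \<Rightarrow> real" and p :: "nat \<Rightarrow> real"
  assumes I: "finite I" and p: "\<And>u. u < m \<Longrightarrow> p u \<ge> 0" "(\<Sum>u<m. p u) = 1"
    and a: "0 < a" "a < 1" and \<epsilon>: "0 < \<epsilon>" "\<epsilon> \<le> 1" and b: "b > 0"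
    and var: "\<And>u. u < m \<Longrightarrow> (\<Sum>i\<in>I. (w i u)\<^sup>2) = S"
  defines "Y \<equiv> \<lambda>y. \<Sum>u<m. p u * exp (\<epsilon> * (b * (\<Sum>i\<in>I. y i * w i u)))"
    and "e \<equiv> exp (\<epsilon>\<^sup>2 * b\<^sup>2 * S / 2)"
  shows "integrable (std_gauss_PiM I) (\<lambda>y. Y y powr a)" (is ?int)
    and "\<bar>(\<integral>y. Y y powr a \<partial>std_gauss_PiM I) - (1 + a * (e - 1)
        - a * (1 - a) / 2 * ((\<Sum>u<m. \<Sum>v<m. p u * p v * exp (\<epsilon>\<^sup>2 * b\<^sup>2 * (S + (\<Sum>i\<in>I. w i u * w i v)))) - 2 * e + 1))\<bar>
      \<le> 96 * real m * exp (8 * b\<^sup>2 * S) * \<epsilon> ^ 3" (is ?approx)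
    and "(\<integral>y. Y y powr a \<partial>std_gauss_PiM I) \<ge> 1" (is ?ge)
proof -
  let ?P = "std_gauss_PiM I"
  define E where "E r y u = exp (r * (\<Sum>i\<in>I. y i * w i u))" for r :: real and y u
  have E_int: "integrable ?P (\<lambda>y. E r y u)" "(\<integral>y. E r y u \<partial>?P) = exp (r\<^sup>2 * S / 2)" if "u < m" for r u
    using integrable_std_gauss_PiM_exp[OF I, of "\<lambda>i. r * w i u"] var[OF that]
    by (simp_all add: E_def sum_distrib_left mult_ac power_mult_distrib flip: sum_distrib_left)
  have E2_int: "integrable ?P (\<lambda>y. E r y u * E r y v)"
    "(\<integral>y. E r y u * E r y v \<partial>?P) = exp (r\<^sup>2 * (S + (\<Sum>i\<in>I. w i u * w i v)))" if "u < m" "v < m" for r u v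
  proof -
    have 1: "E r y u * E r y v = exp (\<Sum>i\<in>I. (r * (w i u + w i v)) * y i)" for y
      by (simp add: E_def sum_distrib_left sum.distrib algebra_simps flip: exp_add)
    have "(\<Sum>i\<in>I. (r * (w i u + w i v))\<^sup>2) = r\<^sup>2 * ((\<Sum>i\<in>I. (w i u)\<^sup>2) + (\<Sum>i\<in>I. (w i v)\<^sup>2) + 2 * (\<Sum>i\<in>I. w i u * w i v))"
      by (simp add: sum_distrib_left sum.distrib power2_eq_square algebra_simps)
    then have 2: "(\<Sum>i\<in>I. (r * (w i u + w i v))\<^sup>2) / 2 = r\<^sup>2 * (S + (\<Sum>i\<in>I. w i u * w i v))"
      by (simp add: var that algebra_simps)
    show "integrable ?P (\<lambda>y. E r y u * E r y v)"
      "(\<integral>y. E r y u * E r y v \<partial>?P) = exp (r\<^sup>2 * (S + (\<Sum>i\<in>I. w i u * w i v)))"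
      using integrable_std_gauss_PiM_exp[OF I, of "\<lambda>i. r * (w i u + w i v)"]
      unfolding 1 2 by simp_all
  qed
  have Y_eq: "Y y = (\<Sum>u<m. p u * E (\<epsilon> * b) y u)" for y
    by (simp add: Y_def E_def mult.assoc)
  have Y_int: "integrable ?P Y" and Y_exp: "(\<integral>y. Y y \<partial>?P) = e"
  proof -
    show "integrable ?P Y" unfolding Y_eq[abs_def] by (intro Bochner_Integration.integrable_sum integrable_mult_right E_int) simp
    have "(\<integral>y. Y y \<partial>?P) = (\<Sum>u<m. p u * e)"
      unfolding Y_eq using E_int by (subst Bochner_Integration.integral_sum) (simp_all add: e_def power_mult_distrib)
    then show "(\<integral>y. Y y \<partial>?P) = e" by (simp add: p(2) flip: sum_distrib_right)
  qed
  \<comment> \<open>The second moment of \<open>Y\<close>. Covariances enter the expansion only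
    here: \<open>D\<close> increases with them, and its coefficient \<open>- a * (1 - a) / 2\<close>
    is negative.\<close>
  define D where "D = (\<Sum>u<m. \<Sum>v<m. p u * p v * exp (\<epsilon>\<^sup>2 * b\<^sup>2 * (S + (\<Sum>i\<in>I. w i u * w i v))))"
  have Y2: "(Y y)\<^sup>2 = (\<Sum>u<m. \<Sum>v<m. p u * p v * (E (\<epsilon> * b) y u * E (\<epsilon> * b) y v))" for y
    by (simp add: Y_eq power2_eq_square sum_product mult_ac)
  have Y2_int: "integrable ?P (\<lambda>y. (Y y)\<^sup>2)" and Y2_exp: "(\<integral>y. (Y y)\<^sup>2 \<partial>?P) = D"
  proof -
    show "integrable ?P (\<lambda>y. (Y y)\<^sup>2)"
      unfolding Y2 by (intro Bochner_Integration.integrable_sum integrable_mult_right E2_int) simp_all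
    show "(\<integral>y. (Y y)\<^sup>2 \<partial>?P) = D"
    proof -
      have "(\<integral>y. (Y y)\<^sup>2 \<partial>?P) = (\<Sum>u<m. \<integral>y. (\<Sum>v<m. p u * p v * (E (\<epsilon> * b) y u * E (\<epsilon> * b) y v)) \<partial>?P)"
        unfolding Y2
        by (intro Bochner_Integration.integral_sum Bochner_Integration.integrable_sum
            integrable_mult_right E2_int) simp_all
      also have "\<dots> = (\<Sum>u<m. \<Sum>v<m. \<integral>y. p u * p v * (E (\<epsilon> * b) y u * E (\<epsilon> * b) y v) \<partial>?P)"
        by (intro sum.cong refl Bochner_Integration.integral_sum integrable_mult_right E2_int) simp_all
      also have "\<dots> = D"
        unfolding D_def by (intro sum.cong refl) (simp add: E2_int power_mult_distrib)
      finally show ?thesis .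
    qed
  qed
  have m: "m > 0" using p(2) by (cases m) auto
  have Y_pos: "Y y > 0" for y
  proof -
    obtain u where "u < m" "p u > 0"
      using p by (metis (no_types, lifting) lessThan_iff less_eq_real_def sum.neutral zero_neq_one)
    then show ?thesis
      unfolding Y_def using p(1) by (intro sum_pos2[of _ u]) auto
  qed
  have [measurable]: "Y \<in> borel_measurable ?P" using Y_int by (rule borel_measurable_integrable)
  have powr_le: "Y y powr a \<le> 1 + Y y" for y
  proof (cases "Y y \<ge> 1")
    case True
    then show ?thesis using powr_mono[of a 1 "Y y"] a by simp
  next
    case False
    then show ?thesis using powr_le1[of a "Y y"] a Y_pos[of y] by simp
  qed
  show ?int
    by (rule Bochner_Integration.integrable_bound[of _ "\<lambda>y. 1 + Y y"])
      (use Y_int powr_le Y_pos in \<open>auto simp: abs_of_pos add_pos_pos intro!: AE_I2\<close>)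
  define Q where "Q y = 1 + a * (Y y - 1) - a * (1 - a) / 2 * (Y y - 1)\<^sup>2" for y
  have Q_alt: "Q y = 1 + a * (Y y - 1) - a * (1 - a) / 2 * ((Y y)\<^sup>2 - 2 * Y y + 1)" for y
    by (simp add: Q_def power2_eq_square algebra_simps)
  have Q_int: "integrable ?P Q"
    unfolding Q_alt[abs_def] using Y_int Y2_int by simp
  have Q_exp: "(\<integral>y. Q y \<partial>?P) = 1 + a * (e - 1) - a * (1 - a) / 2 * (D - 2 * e + 1)"
    unfolding Q_alt using Y_int Y2_int by (simp add: prob_space.prob_space[OF prob_space_PiM[OF prob_space_std_gauss]] Y_exp Y2_exp)
  \<comment> \<open>Bounds the expansion error: \<open>48 = 8 * 6\<close> multiplies the constants
    of the two preceding lemmas, and summing over all \<open>u\<close> covers whichever index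
    realises the pointwise bound.\<close>
  define R where "R y = (\<Sum>u<m. 48 * \<epsilon> ^ 3 * (E (4 * b) y u + E (- 4 * b) y u))" for y
  have R_int: "integrable ?P R"
    unfolding R_def[abs_def]
    by (intro Bochner_Integration.integrable_sum integrable_mult_right Bochner_Integration.integrable_add E_int) simp_all
  have R_exp: "(\<integral>y. R y \<partial>?P) = 96 * real m * exp (8 * b\<^sup>2 * S) * \<epsilon> ^ 3"
  proof -
    have "(\<integral>y. R y \<partial>?P) = (\<Sum>u<m. \<integral>y. 48 * \<epsilon> ^ 3 * (E (4 * b) y u + E (- 4 * b) y u) \<partial>?P)"
      unfolding R_def
      by (intro Bochner_Integration.integral_sum integrable_mult_right Bochner_Integration.integrable_add E_int) simp_all
    also have "\<dots> = (\<Sum>u<m. 96 * exp (8 * b\<^sup>2 * S) * \<epsilon> ^ 3)"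
      by (intro sum.cong refl) (simp add: E_int power_mult_distrib)
    finally show ?thesis by simp
  qed
  have err: "\<bar>Y y powr a - Q y\<bar> \<le> R y" for y
  proof -
    let ?d = "\<lambda>u. exp (\<epsilon> * (b * (\<Sum>i\<in>I. y i * w i u))) - 1"
    \<comment> \<open>\<open>Y y - 1\<close> is the average of the \<open>?d u\<close> with weights
      \<open>p u\<close>, so not all of them can be smaller in absolute value.\<close>
    have "\<exists>u<m. \<bar>Y y - 1\<bar> \<le> \<bar>?d u\<bar>"
    proof (rule ccontr)
      assume "\<not> ?thesis"
      then have less: "\<bar>?d u\<bar> < \<bar>Y y - 1\<bar>" if "u < m" for u using that by force
      obtain u where u: "u < m" "p u > 0"
        using p by (metis (no_types, lifting) lessThan_iff less_eq_real_def sum.neutral zero_neq_one)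
      have "Y y - 1 = (\<Sum>u<m. p u * ?d u)"
        by (simp add: Y_def p(2) algebra_simps sum_subtractf)
      then have "\<bar>Y y - 1\<bar> \<le> (\<Sum>u<m. p u * \<bar>?d u\<bar>)"
        using p(1) by (auto intro!: order_trans[OF sum_abs] sum_mono simp: abs_mult)
      also have "\<dots> < (\<Sum>u<m. p u * \<bar>Y y - 1\<bar>)"
      proof (rule sum_strict_mono_ex1)
        show "\<forall>u\<in>{..<m}. p u * \<bar>?d u\<bar> \<le> p u * \<bar>Y y - 1\<bar>"
          using less p(1) by (metis lessThan_iff less_imp_le mult_left_mono)
        show "\<exists>u\<in>{..<m}. p u * \<bar>?d u\<bar> < p u * \<bar>Y y - 1\<bar>"
          using less[OF u(1)] u by (intro bexI[of _ u]) (auto intro: mult_strict_left_mono)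
      qed simp
      finally show False by (simp add: p(2) flip: sum_distrib_right)
    qed
    then obtain u where u: "u < m" "\<bar>Y y - 1\<bar> \<le> \<bar>?d u\<bar>" by blast
    have "\<bar>Y y powr a - Q y\<bar> \<le> 8 * \<bar>Y y - 1\<bar> ^ 3"
      unfolding Q_def using a Y_pos by (rule powr_second_order)
    also have "\<dots> \<le> 8 * \<bar>?d u\<bar> ^ 3"
      using u by (simp add: power_mono)
    also have "\<dots> \<le> 8 * (6 * \<epsilon> ^ 3 * (E (4 * b) y u + E (- 4 * b) y u))"
      using abs_exp_minus_one_cube_le[of \<epsilon> "b * (\<Sum>i\<in>I. y i * w i u)"] \<epsilon>
      by (simp add: E_def mult.assoc)
    also have "\<dots> = 48 * \<epsilon> ^ 3 * (E (4 * b) y u + E (- 4 * b) y u)" by simp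
    also have "\<dots> \<le> R y"
      unfolding R_def using u(1) \<epsilon> by (intro member_le_sum) (auto simp: E_def)
    finally show ?thesis .
  qed
  have "\<bar>(\<integral>y. Y y powr a \<partial>?P) - (\<integral>y. Q y \<partial>?P)\<bar> = \<bar>\<integral>y. Y y powr a - Q y \<partial>?P\<bar>"
    using \<open>?int\<close> Q_int by simp
  also have "\<dots> \<le> (\<integral>y. \<bar>Y y powr a - Q y\<bar> \<partial>?P)"
    by (rule integral_abs_bound)
  also have "\<dots> \<le> (\<integral>y. R y \<partial>?P)"
    using \<open>?int\<close> Q_int R_int err by (intro integral_mono) auto
  finally show ?approx
    by (simp only: Q_exp R_exp D_def)
  show ?ge
  proof -
    \<comment> \<open>By Jensen, \<open>Y\<close> is at least the exponential of the averaged
      exponents. Its power \<open>a\<close> is then at least the exponential of a centred Gaussian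
      form, whose expectation is at least 1. The coefficients of that form are
      \<open>c\<close>.\<close>
    define c where "c i = a * \<epsilon> * b * (\<Sum>u<m. p u * w i u)" for i
    have "exp (\<Sum>i\<in>I. c i * y i) \<le> Y y powr a" for y
    proof -
      let ?t = "\<lambda>u. \<epsilon> * (b * (\<Sum>i\<in>I. y i * w i u))"
      have "(\<Sum>i\<in>I. c i * y i) = a * (\<Sum>u<m. p u * ?t u)"
        unfolding c_def sum_distrib_left sum_distrib_right
        by (subst sum.swap) (simp add: mult_ac)
      moreover have "exp (\<Sum>u<m. p u * ?t u) \<le> Y y"
        using convex_on_sum[OF _ _ exp_convex, of "{..<m}" p ?t] p m
        by (auto simp: Y_def)
      ultimately show ?thesis
        using a Y_pos[of y] powr_mono2[of a "exp (\<Sum>u<m. p u * ?t u)" "Y y"]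
        by (simp add: powr_def mult.commute)
    qed
    then have "(\<integral>y. exp (\<Sum>i\<in>I. c i * y i) \<partial>?P) \<le> (\<integral>y. Y y powr a \<partial>?P)"
      using \<open>?int\<close> integrable_std_gauss_PiM_exp(1)[OF I, of c] by (intro integral_mono) auto
    moreover have "1 \<le> (\<integral>y. exp (\<Sum>i\<in>I. c i * y i) \<partial>?P)"
      by (simp add: integrable_std_gauss_PiM_exp(2)[OF I] sum_nonneg)
    ultimately show ?thesis by linarith
  qed
qed

text \<open>For \<open>a = \<Lambda> / b\<close> this is the exponential of \<open>\<Lambda>\<close>
  times the soft maximum \<open>ln (\<Sum>l<m. exp (b * x l)) / b\<close>. An exponent below 1 makes
  the power concave, which fixes the direction of the comparison.\<close>

definition lse_powr :: "nat \<Rightarrow> real \<Rightarrow> real \<Rightarrow> (nat \<Rightarrow> real) \<Rightarrow> ennreal" where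
  "lse_powr m b a x = ennreal ((\<Sum>l<m. exp (b * x l)) powr a)"

lemma measurable_lse_powr [measurable]: "lse_powr m b a \<in> borel_measurable borel"
proof -
  have [measurable]: "(\<lambda>x :: nat \<Rightarrow> real. x l) \<in> borel_measurable borel" for l
    by (rule measurable_product_coordinates)
  show ?thesis unfolding lse_powr_def[abs_def] by measurable
qed

text \<open>Two centred Gaussian processes on \<open>m\<close> points with common variance
  \<open>S\<close>. The one over \<open>J\<close> is less correlated, so the exponential moment of
  its maximum is the larger one.\<close>

locale slepian =
  fixes I :: "'i set" and J :: "'j set"
    and w :: "'i \<Rightarrow> nat \<Rightarrow> real" and w' :: "'j \<Rightarrow> nat \<Rightarrow> real" and m :: nat and S :: real
  assumes finite_I: "finite I" and finite_J: "finite J" and m_pos: "m > 0"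
    and var_I: "\<And>u. u < m \<Longrightarrow> (\<Sum>i\<in>I. (w i u)\<^sup>2) = S"
    and var_J: "\<And>u. u < m \<Longrightarrow> (\<Sum>i\<in>J. (w' i u)\<^sup>2) = S"
    and cov_le: "\<And>u v. u < m \<Longrightarrow> v < m \<Longrightarrow> (\<Sum>i\<in>J. w' i u * w' i v) \<le> (\<Sum>i\<in>I. w i u * w i v)"
begin

text \<open>Normalising the weights \<open>exp (b * x l)\<close> to a probability vector pulls out
  the factor \<open>s powr a\<close> and leaves the expansion of \<open>gauss_small_step\<close>.
  Equal variances make the first-order terms agree; the ordered covariances decide the second-order
  ones.\<close>

lemma gauss_op_small_step:
  assumes a: "0 < a" "a < 1" and b: "b > 0" and \<epsilon>: "0 < \<epsilon>" "\<epsilon> \<le> 1"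
  shows "gauss_op I w \<epsilon> (lse_powr m b a) x
    \<le> ennreal (1 + 192 * real m * exp (8 * b\<^sup>2 * S) * \<epsilon> ^ 3) * gauss_op J w' \<epsilon> (lse_powr m b a) x"
proof -
  define s where "s = (\<Sum>l<m. exp (b * x l))"
  have s: "s > 0" unfolding s_def using m_pos by (intro sum_pos) auto
  define p where "p l = exp (b * x l) / s" for l
  have p: "p l \<ge> 0" for l using s by (simp add: p_def)
  have p_sum: "(\<Sum>l<m. p l) = 1"
    using s by (simp add: p_def s_def flip: sum_divide_distrib)
  define Y where "Y A = (\<Sum>u<m. p u * exp (\<epsilon> * (b * A u)))" for A
  have op: "gauss_op K v \<epsilon> (lse_powr m b a) x
      = ennreal (s powr a * (\<integral>y. Y (\<lambda>u. \<Sum>i\<in>K. y i * v i u) powr a \<partial>std_gauss_PiM K))"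
    if "integrable (std_gauss_PiM K) (\<lambda>y. Y (\<lambda>u. \<Sum>i\<in>K. y i * v i u) powr a)" for K and v :: "'k \<Rightarrow> nat \<Rightarrow> real"
  proof -
    have eq: "(\<Sum>l<m. exp (b * (x l + \<epsilon> * A l))) = s * Y A" for A
      using s by (simp add: Y_def p_def sum_distrib_left exp_add algebra_simps)
    have Y_nonneg: "Y A \<ge> 0" for A
      using p by (simp add: Y_def sum_nonneg)
    have "gauss_op K v \<epsilon> (lse_powr m b a) x
        = (\<integral>\<^sup>+ y. ennreal (s powr a * Y (\<lambda>u. \<Sum>i\<in>K. y i * v i u) powr a) \<partial>std_gauss_PiM K)"
      unfolding gauss_op_def lse_powr_def eq using s Y_nonneg by (simp add: powr_mult)
    also have "\<dots> = ennreal (\<integral>y. s powr a * Y (\<lambda>u. \<Sum>i\<in>K. y i * v i u) powr a \<partial>std_gauss_PiM K)"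
      by (rule nn_integral_eq_integral) (use that in auto)
    finally show ?thesis by simp
  qed
  let ?C = "96 * real m * exp (8 * b\<^sup>2 * S) * \<epsilon> ^ 3"
  let ?EI = "\<integral>y. Y (\<lambda>u. \<Sum>i\<in>I. y i * w i u) powr a \<partial>std_gauss_PiM I"
  let ?EJ = "\<integral>y. Y (\<lambda>u. \<Sum>i\<in>J. y i * w' i u) powr a \<partial>std_gauss_PiM J"
  note stepI = gauss_small_step[where w = w and m = m and p = p, OF finite_I p p_sum a \<epsilon> b var_I, folded Y_def]
  note stepJ = gauss_small_step[where w = w' and m = m and p = p, OF finite_J p p_sum a \<epsilon> b var_J, folded Y_def]
  \<comment> \<open>\<open>X\<close> and \<open>r\<close> stand for what the two expansions share,
    \<open>d\<close> and \<open>d'\<close> for their second moments.\<close>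
  have lin: "x \<le> y + (C + C)"
    if "\<bar>x - (X - c * (d - r + 1))\<bar> \<le> C" "\<bar>y - (X - c * (d' - r + 1))\<bar> \<le> C" "c * d' \<le> c * d"
    for x y X c d d' r C :: real
    using that by (simp add: algebra_simps abs_le_iff)
  have cov: "a * (1 - a) / 2 * (\<Sum>u<m. \<Sum>v<m. p u * p v * exp (\<epsilon>\<^sup>2 * b\<^sup>2 * (S + (\<Sum>i\<in>J. w' i u * w' i v))))
      \<le> a * (1 - a) / 2 * (\<Sum>u<m. \<Sum>v<m. p u * p v * exp (\<epsilon>\<^sup>2 * b\<^sup>2 * (S + (\<Sum>i\<in>I. w i u * w i v))))"
    using a p by (intro mult_left_mono sum_mono) (auto intro!: mult_left_mono cov_le)
  have "?EI \<le> ?EJ + (?C + ?C)"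
    by (rule lin[OF stepI(2) stepJ(2) cov])
  \<comment> \<open>The lower bound 1 on \<open>?EJ\<close> turns the additive error into a relative
    one, which can be iterated.\<close>
  also have "\<dots> \<le> ?EJ + (?C + ?C) * ?EJ"
  proof -
    have "(?C + ?C) * 1 \<le> (?C + ?C) * ?EJ"
      using stepJ(3) \<epsilon> by (intro mult_left_mono) auto
    then show ?thesis by simp
  qed
  also have "\<dots> = (1 + 192 * real m * exp (8 * b\<^sup>2 * S) * \<epsilon> ^ 3) * ?EJ"
    by (simp add: algebra_simps)
  finally have "s powr a * ?EI \<le> (1 + 192 * real m * exp (8 * b\<^sup>2 * S) * \<epsilon> ^ 3) * (s powr a * ?EJ)"
    using mult_left_mono[of ?EI _ "s powr a"] by (simp add: mult.left_commute)
  then have "ennreal (s powr a * ?EI)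
      \<le> ennreal ((1 + 192 * real m * exp (8 * b\<^sup>2 * S) * \<epsilon> ^ 3) * (s powr a * ?EJ))"
    by (rule ennreal_leI)
  also have "\<dots> = ennreal (1 + 192 * real m * exp (8 * b\<^sup>2 * S) * \<epsilon> ^ 3) * ennreal (s powr a * ?EJ)"
    using stepJ(3) by (intro ennreal_mult'') simp
  finally show ?thesis
    by (simp only: op[OF stepI(1)] op[OF stepJ(1)])
qed

text \<open>Induction on the number of increments, counted as \<open>Suc j\<close> because the
  semigroup law is stated for positive times only.\<close>

lemma gauss_op_iterate:
  assumes a: "0 < a" "a < 1" and b: "b > 0" and \<epsilon>: "0 < \<epsilon>" "\<epsilon> \<le> 1"
  defines "C \<equiv> 1 + 192 * real m * exp (8 * b\<^sup>2 * S) * \<epsilon> ^ 3"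
  shows "gauss_op I w (sqrt (real (Suc j)) * \<epsilon>) (lse_powr m b a) x
    \<le> ennreal (C ^ Suc j) * gauss_op J w' (sqrt (real (Suc j)) * \<epsilon>) (lse_powr m b a) x"
proof (induction j arbitrary: x)
  case 0
  then show ?case
    using gauss_op_small_step[OF a b \<epsilon>] by (simp add: C_def)
next
  case (Suc j)
  let ?F = "lse_powr m b a"
  let ?r = "sqrt (real (Suc j)) * \<epsilon>"
  have r: "?r > 0" using \<epsilon> by simp
  have sq: "sqrt (\<epsilon>\<^sup>2 + ?r\<^sup>2) = sqrt (real (Suc (Suc j))) * \<epsilon>" "sqrt (?r\<^sup>2 + \<epsilon>\<^sup>2) = sqrt (real (Suc (Suc j))) * \<epsilon>"
  proof -
    have "\<epsilon>\<^sup>2 + ?r\<^sup>2 = real (Suc (Suc j)) * \<epsilon>\<^sup>2" by (simp add: power_mult_distrib algebra_simps)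
    then show "sqrt (\<epsilon>\<^sup>2 + ?r\<^sup>2) = sqrt (real (Suc (Suc j))) * \<epsilon>" using \<epsilon> by (simp only: real_sqrt_mult) simp
    then show "sqrt (?r\<^sup>2 + \<epsilon>\<^sup>2) = sqrt (real (Suc (Suc j))) * \<epsilon>" by (simp only: add.commute)
  qed
  have C: "C \<ge> 0" using \<epsilon> by (simp add: C_def)
  have "gauss_op I w (sqrt (real (Suc (Suc j))) * \<epsilon>) ?F x = gauss_op I w \<epsilon> (gauss_op I w ?r ?F) x"
    using gauss_op_semigroup[OF finite_I measurable_lse_powr \<epsilon>(1) r] by (simp only: sq)
  also have "\<dots> \<le> gauss_op I w \<epsilon> (\<lambda>x. ennreal (C ^ Suc j) * gauss_op J w' ?r ?F x) x"
    by (rule gauss_op_mono) (rule Suc.IH)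
  also have "\<dots> = ennreal (C ^ Suc j) * gauss_op I w \<epsilon> (gauss_op J w' ?r ?F) x"
    by (intro gauss_op_cmult finite_I measurable_gauss_op finite_J measurable_lse_powr)
  \<comment> \<open>The one-step comparison is available only for \<open>lse_powr\<close>, so the
    remaining \<open>I\<close>-increment is moved inside to act on it directly.\<close>
  also have "\<dots> = ennreal (C ^ Suc j) * gauss_op J w' ?r (gauss_op I w \<epsilon> ?F) x"
    by (simp only: gauss_op_commute[OF finite_I finite_J measurable_lse_powr])
  also have "\<dots> \<le> ennreal (C ^ Suc j) * gauss_op J w' ?r (\<lambda>x. ennreal C * gauss_op J w' \<epsilon> ?F x) x"
    unfolding C_def by (intro mult_left_mono gauss_op_mono gauss_op_small_step a b \<epsilon>) simp
  also have "\<dots> = ennreal (C ^ Suc j) * (ennreal C * gauss_op J w' ?r (gauss_op J w' \<epsilon> ?F) x)"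
    by (subst gauss_op_cmult) (intro finite_J measurable_gauss_op measurable_lse_powr refl)+
  also have "\<dots> = ennreal (C ^ Suc (Suc j)) * gauss_op J w' (sqrt (real (Suc (Suc j))) * \<epsilon>) ?F x"
    unfolding gauss_op_semigroup[OF finite_J measurable_lse_powr r \<epsilon>(1)] sq
    using C by (simp add: ennreal_mult mult_ac)
  finally show ?case .
qed

text \<open>With \<open>N\<close> increments of size \<open>1 / sqrt N\<close> the accumulated
  factor is at most \<open>exp (K / sqrt N)\<close>, which tends to 1. An infinite right-hand side
  leaves nothing to prove.\<close>

lemma gauss_op_lse_powr_le:
  assumes a: "0 < a" "a < 1" and b: "b > 0"
  shows "gauss_op I w 1 (lse_powr m b a) x \<le> gauss_op J w' 1 (lse_powr m b a) x"
proof (cases "gauss_op J w' 1 (lse_powr m b a) x")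
  case (real g)
  define K where "K = 192 * real m * exp (8 * b\<^sup>2 * S)"
  have K: "K \<ge> 0" by (simp add: K_def)
  have bound: "gauss_op I w 1 (lse_powr m b a) x \<le> ennreal (exp (K / sqrt (real (Suc j))) * g)" for j
  proof -
    let ?N = "real (Suc j)"
    define \<epsilon> where "\<epsilon> = 1 / sqrt ?N"
    have \<epsilon>: "0 < \<epsilon>" "\<epsilon> \<le> 1" "sqrt ?N * \<epsilon> = 1" by (simp_all add: \<epsilon>_def)
    have "(1 + K * \<epsilon> ^ 3) ^ Suc j \<le> exp (K * \<epsilon> ^ 3) ^ Suc j"
      using K \<epsilon> by (intro power_mono exp_ge_add_one_self) auto
    also have "\<dots> = exp (?N * (K * \<epsilon> ^ 3))"
      by (rule exp_of_nat_mult[symmetric])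
    also have "?N * (K * \<epsilon> ^ 3) = K / sqrt ?N"
    proof -
      have "?N * \<epsilon>\<^sup>2 = 1" by (simp add: \<epsilon>_def power_divide)
      then have "?N * (K * \<epsilon> ^ 3) = K * \<epsilon>" by (simp add: eval_nat_numeral mult_ac)
      then show ?thesis by (simp add: \<epsilon>_def)
    qed
    finally have "ennreal ((1 + K * \<epsilon> ^ 3) ^ Suc j) * ennreal g \<le> ennreal (exp (K / sqrt ?N)) * ennreal g"
      by (intro mult_right_mono ennreal_leI) auto
    then show ?thesis
      using gauss_op_iterate[OF a b \<epsilon>(1,2), of j x] real
      by (simp only: \<epsilon>(3) K_def[symmetric] ennreal_mult[OF exp_ge_zero])
  qed
  have "(\<lambda>j. ennreal (exp (K / sqrt (real (Suc j))) * g)) \<longlonglongrightarrow> ennreal (exp 0 * g)"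
  proof -
    have "(\<lambda>j. K / sqrt (real (Suc j))) \<longlonglongrightarrow> 0"
      by real_asymp
    then show ?thesis
      by (intro tendsto_ennrealI tendsto_mult tendsto_exp tendsto_const)
  qed
  then have "gauss_op I w 1 (lse_powr m b a) x \<le> ennreal (exp 0 * g)"
    by (rule LIMSEQ_le_const) (use bound in blast)
  then show ?thesis using real by simp
qed simp

definition top_exp :: "real \<Rightarrow> (nat \<Rightarrow> real) \<Rightarrow> ennreal" where
  "top_exp \<Lambda> x = ennreal (exp (\<Lambda> * Max (x ` {..<m})))"

text \<open>A sum of \<open>m\<close> positive terms lies between its largest term and
  \<open>m\<close> times that term. The resulting gap \<open>m powr (\<Lambda> / b)\<close> closes
  as \<open>b\<close> grows.\<close>

lemma lse_powr_bounds:
  assumes "b > 0" "\<Lambda> > 0"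
  shows "top_exp \<Lambda> x \<le> lse_powr m b (\<Lambda> / b) x"
    and "lse_powr m b (\<Lambda> / b) x \<le> ennreal (real m powr (\<Lambda> / b)) * top_exp \<Lambda> x"
proof -
  let ?M = "Max (x ` {..<m})"
  have *: "exp (b * ?M) powr (\<Lambda> / b) = exp (\<Lambda> * ?M)"
    using assms by (simp add: powr_def)
  have "?M \<in> x ` {..<m}" using m_pos by (intro Max_in) auto
  then obtain l where l: "l < m" "?M = x l" by auto
  have "exp (b * ?M) \<le> (\<Sum>l<m. exp (b * x l))"
    unfolding l(2) by (intro member_le_sum) (use l in auto)
  then have "exp (b * ?M) powr (\<Lambda> / b) \<le> (\<Sum>l<m. exp (b * x l)) powr (\<Lambda> / b)"
    using assms by (intro powr_mono2) auto
  then show "top_exp \<Lambda> x \<le> lse_powr m b (\<Lambda> / b) x"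
    unfolding top_exp_def lse_powr_def * by (rule ennreal_leI)
  have "(\<Sum>l<m. exp (b * x l)) \<le> (\<Sum>l<m. exp (b * ?M))"
    using assms by (intro sum_mono) auto
  then have "(\<Sum>l<m. exp (b * x l)) powr (\<Lambda> / b) \<le> (real m * exp (b * ?M)) powr (\<Lambda> / b)"
    using assms by (intro powr_mono2) (auto intro: sum_nonneg)
  also have "\<dots> = real m powr (\<Lambda> / b) * exp (\<Lambda> * ?M)"
    by (simp add: powr_mult *)
  finally show "lse_powr m b (\<Lambda> / b) x \<le> ennreal (real m powr (\<Lambda> / b)) * top_exp \<Lambda> x"
    unfolding lse_powr_def top_exp_def by (subst ennreal_mult[symmetric]) (auto intro: ennreal_leI)
qed

lemma measurable_top_exp: "top_exp \<Lambda> \<in> borel_measurable borel"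
proof -
  have [measurable]: "(\<lambda>x :: nat \<Rightarrow> real. x l) \<in> borel_measurable borel" for l
    by (rule measurable_product_coordinates)
  have "(\<lambda>x :: nat \<Rightarrow> real. Max ((\<lambda>l. x l) ` {..<m})) \<in> borel_measurable borel"
    using m_pos by (intro borel_measurable_Max) auto
  then show ?thesis unfolding top_exp_def[abs_def] by measurable
qed

text \<open>Limit \<open>b\<close> to infinity of the soft-maximum comparison. Taking
  \<open>b > \<Lambda>\<close> puts the exponent \<open>\<Lambda> / b\<close> strictly between 0 and
  1.\<close>

lemma gauss_op_top_exp_le:
  assumes \<Lambda>: "\<Lambda> > 0"
  shows "gauss_op I w 1 (top_exp \<Lambda>) x \<le> gauss_op J w' 1 (top_exp \<Lambda>) x"
proof (cases "gauss_op J w' 1 (top_exp \<Lambda>) x")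
  case (real g)
  have bound: "gauss_op I w 1 (top_exp \<Lambda>) x \<le> ennreal (real m powr (\<Lambda> / real b) * g)"
    if "real b > \<Lambda>" for b :: nat
  proof -
    have b: "real b > 0" "0 < \<Lambda> / real b" "\<Lambda> / real b < 1" using that \<Lambda> by (auto simp: field_simps)
    have "gauss_op I w 1 (top_exp \<Lambda>) x \<le> gauss_op I w 1 (lse_powr m b (\<Lambda> / b)) x"
      by (intro gauss_op_mono lse_powr_bounds b \<Lambda>)
    also have "\<dots> \<le> gauss_op J w' 1 (lse_powr m b (\<Lambda> / b)) x"
      by (intro gauss_op_lse_powr_le b)
    also have "\<dots> \<le> gauss_op J w' 1 (\<lambda>x. ennreal (real m powr (\<Lambda> / b)) * top_exp \<Lambda> x) x"
      by (intro gauss_op_mono lse_powr_bounds b \<Lambda>)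
    also have "\<dots> = ennreal (real m powr (\<Lambda> / b)) * gauss_op J w' 1 (top_exp \<Lambda>) x"
      by (intro gauss_op_cmult finite_J measurable_top_exp)
    finally show ?thesis using real by (simp add: ennreal_mult)
  qed
  have "(\<lambda>b. ennreal (real m powr (\<Lambda> / real b) * g)) \<longlonglongrightarrow> ennreal (real m powr 0 * g)"
  proof -
    have "(\<lambda>b. \<Lambda> / real b) \<longlonglongrightarrow> 0" by real_asymp
    then show ?thesis
      using m_pos by (intro tendsto_ennrealI tendsto_mult tendsto_powr tendsto_const) auto
  qed
  moreover have "\<exists>N. \<forall>b\<ge>N. gauss_op I w 1 (top_exp \<Lambda>) x \<le> ennreal (real m powr (\<Lambda> / real b) * g)"
  proof -
    obtain N where "\<Lambda> < real N" using reals_Archimedean2 by blast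
    then show ?thesis using bound by (intro exI[of _ N]) force
  qed
  ultimately have "gauss_op I w 1 (top_exp \<Lambda>) x \<le> ennreal (real m powr 0 * g)"
    by (rule LIMSEQ_le_const)
  then show ?thesis using real m_pos by simp
qed simp

end

section \<open>Exponential moment of the tensor maximum\<close>

lemma finite_multi_indices [simp]: "finite (multi_indices k n)"
  by (simp add: multi_indices_def finite_PiE)

lemma inner_tensor_power:
  "inner_tensor k n (tensor_power k u) (tensor_power k v) = inner_vec n u v ^ k"
proof -
  have "inner_vec n u v ^ k = (\<Prod>j<k. \<Sum>i<n. u i * v i)"
    by (simp add: inner_vec_def)
  also have "\<dots> = (\<Sum>i\<in>multi_indices k n. \<Prod>j<k. u (i j) * v (i j))"
    unfolding multi_indices_def by (rule prod_sum_PiE) auto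
  finally show ?thesis
    by (simp add: inner_tensor_def tensor_power_def prod.distrib)
qed

text \<open>A tensor power is invariant under permuting its indices, so all \<open>fact k\<close>
  permuted copies of \<open>G\<close> contribute equally and cancel the normalisation.\<close>

lemma inner_symmetric_noise:
  "inner_tensor k n (symmetric_noise k n G) (tensor_power k v)
    = sqrt (real k / real n) * inner_tensor k n G (tensor_power k v)"
proof -
  have perm: "(\<Sum>i\<in>multi_indices k n. G (i \<circ> \<pi>) * tensor_power k v i)
      = inner_tensor k n G (tensor_power k v)" if \<pi>: "\<pi> permutes {..<k}" for \<pi>
    unfolding inner_tensor_def
  proof (rule sum.reindex_bij_witness[of _ "\<lambda>i. i \<circ> inv \<pi>" "\<lambda>i. i \<circ> \<pi>"])
    have comp: "i \<circ> \<rho> \<in> multi_indices k n" if "i \<in> multi_indices k n" "\<rho> permutes {..<k}" for i \<rho>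
      using that permutes_in_image[OF that(2)] permutes_not_in[OF that(2)]
      by (auto simp: multi_indices_def PiE_def Pi_def extensional_def)
    fix i assume i: "i \<in> multi_indices k n"
    show "i \<circ> \<pi> \<in> multi_indices k n" "i \<circ> inv \<pi> \<in> multi_indices k n"
      using comp[OF i \<pi>] comp[OF i permutes_inv[OF \<pi>]] by simp_all
    show "i \<circ> \<pi> \<circ> inv \<pi> = i" "i \<circ> inv \<pi> \<circ> \<pi> = i"
      using permutes_inv_o[OF \<pi>] by (simp_all add: comp_assoc)
    have "(\<Prod>j<k. v (i (\<pi> j))) = (\<Prod>j<k. v (i j))"
      using prod.permute[OF \<pi>, of "\<lambda>j. v (i j)"] by (simp add: o_def)
    then show "G (i \<circ> \<pi>) * tensor_power k v (i \<circ> \<pi>) = G (i \<circ> \<pi>) * tensor_power k v i"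
      by (simp add: tensor_power_def)
  qed
  have "inner_tensor k n (symmetric_noise k n G) (tensor_power k v)
      = 1 / fact k * sqrt (real k / real n) *
        (\<Sum>i\<in>multi_indices k n. \<Sum>\<pi> | \<pi> permutes {..<k}. G (i \<circ> \<pi>) * tensor_power k v i)"
    by (simp add: inner_tensor_def symmetric_noise_def sum_distrib_left sum_distrib_right mult_ac)
  also have "(\<Sum>i\<in>multi_indices k n. \<Sum>\<pi> | \<pi> permutes {..<k}. G (i \<circ> \<pi>) * tensor_power k v i)
      = (\<Sum>\<pi> | \<pi> permutes {..<k}. inner_tensor k n G (tensor_power k v))"
    by (subst sum.swap) (simp add: perm)
  also have "\<dots> = fact k * inner_tensor k n G (tensor_power k v)"
    by (simp add: card_permutations)
  finally show ?thesis by simp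
qed

section \<open>Covariance ordering on the sphere and the resulting moment bound\<close>

lemma inner_vec_unit_sphere:
  assumes "u \<in> unit_sphere n"
  shows "inner_vec n u u = 1"
  using assms by (auto simp: unit_sphere_def simp flip: norm_vec_squared)

text \<open>Cauchy-Schwarz, read off from the nonnegativity of the loss.\<close>

lemma abs_inner_vec_le_1:
  assumes "u \<in> unit_sphere n" "v \<in> unit_sphere n"
  shows "\<bar>inner_vec n u v\<bar> \<le> 1"
proof -
  have "0 \<le> loss n u v" by (simp add: loss_def)
  then show ?thesis using loss_eq[OF assms] by linarith
qed

text \<open>The covariance condition of Slepian's comparison for \<open>q\<close> an inner product
  of unit vectors. For \<open>q \<ge> 0\<close> the left side minus \<open>k - 1\<close> is the
  tangent of \<open>q ^ k\<close> at 1; for negative \<open>q\<close> already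
  \<open>q \<le> q ^ k\<close>. Equality at \<open>q = 1\<close> matches the variances.\<close>

lemma bernoulli_tangent:
  fixes q :: real
  assumes "\<bar>q\<bar> \<le> 1" "k \<ge> 1"
  shows "real k * q \<le> q ^ k + real (k - 1)"
proof (cases "q \<ge> 0")
  case True
  then show ?thesis
    using Bernoulli_inequality[of "q - 1" k] assms by (simp add: of_nat_diff algebra_simps)
next
  case False
  have "\<bar>q\<bar> ^ k \<le> \<bar>q\<bar> ^ 1" using assms by (intro power_decreasing) auto
  then have "\<bar>q ^ k\<bar> \<le> \<bar>q\<bar>" by (simp add: power_abs)
  then have "q \<le> q ^ k" using False by linarith
  moreover have "real (k - 1) * q \<le> 0" using False by (simp add: mult_nonneg_nonpos)
  moreover have "real k * q = q + real (k - 1) * q"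
    using assms by (simp add: of_nat_diff algebra_simps)
  ultimately show ?thesis by simp
qed

text \<open>The extra index of the comparison process has to lie outside \<open>multi_indices k n\<close>,
  all of whose members take the value \<open>undefined\<close> at \<open>k\<close>.\<close>

lemma exp_moment_max_tensor:
  fixes v :: "nat \<Rightarrow> nat \<Rightarrow> real"
  assumes k: "k \<ge> 1" and n: "n \<ge> 1" and m: "m > 0"
    and v: "\<And>l. l < m \<Longrightarrow> v l \<in> unit_sphere n"
    and l: "l > 0" and c: "c > 0"
  shows "(\<integral>\<^sup>+ y. ennreal (exp (sqrt (real n) * l *
            Max ((\<lambda>u. inner_tensor k n y (tensor_power k (v u))) ` {..<m}))) \<partial>std_gauss_PiM (multi_indices k n))
    \<le> ennreal (exp (real n / 2 * (l\<^sup>2 + l * c * real k + ln (1 + l / c))))"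
proof -
  let ?MI = "multi_indices k n"
  define i0 :: "nat \<Rightarrow> nat" where "i0 = (\<lambda>_. Suc undefined)"
  have i0: "i0 \<notin> ?MI"
  proof
    assume "i0 \<in> ?MI"
    then have "i0 k = undefined" by (simp add: multi_indices_def PiE_def extensional_def)
    then show False by (simp add: i0_def)
  qed
  \<comment> \<open>The coordinate \<open>i0\<close> carries one noise variable common to all
    points, which adds \<open>k - 1\<close> to every covariance; \<open>w'\<close> describes the
    linear process \<open>sqrt k * \<langle>g, v\<rangle>\<close>.\<close>
  define w where "w i u = (if i = i0 then sqrt (real (k - 1)) else tensor_power k (v u) i)" for i u
  define w' where "w' j u = sqrt (real k) * v u j" for j u
  have covw: "(\<Sum>i\<in>insert i0 ?MI. w i p * w i q) = real (k - 1) + inner_vec n (v p) (v q) ^ k" for p q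
  proof -
    have "(\<Sum>i\<in>?MI. w i p * w i q) = inner_tensor k n (tensor_power k (v p)) (tensor_power k (v q))"
      unfolding inner_tensor_def by (intro sum.cong) (use i0 in \<open>auto simp: w_def\<close>)
    then show ?thesis using i0 by (simp add: w_def inner_tensor_power)
  qed
  have covw': "(\<Sum>j<n. w' j p * w' j q) = real k * inner_vec n (v p) (v q)" for p q
  proof -
    have "w' j p * w' j q = (sqrt (real k) * sqrt (real k)) * (v p j * v q j)" for j
      by (simp only: w'_def mult_ac)
    then show ?thesis by (simp add: inner_vec_def sum_distrib_left)
  qed
  interpret slepian "insert i0 ?MI" "{..<n}" w w' m "real k"
  proof
    show "(\<Sum>i\<in>insert i0 ?MI. (w i u)\<^sup>2) = real k" if "u < m" for u
      using covw[of u u] inner_vec_unit_sphere[OF v[OF that]] k by (simp add: power2_eq_square of_nat_diff)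
    show "(\<Sum>j<n. (w' j u)\<^sup>2) = real k" if "u < m" for u
      using covw'[of u u] inner_vec_unit_sphere[OF v[OF that]] by (simp add: power2_eq_square)
    show "(\<Sum>j<n. w' j p * w' j q) \<le> (\<Sum>i\<in>insert i0 ?MI. w i p * w i q)" if "p < m" "q < m" for p q
      unfolding covw covw'
      using bernoulli_tangent[OF abs_inner_vec_le_1[OF v[OF that(1)] v[OF that(2)]] k] by simp
  qed (use m in auto)
  define \<Lambda> where "\<Lambda> = sqrt (real n) * l"
  have \<Lambda>: "\<Lambda> > 0" using n l by (simp add: \<Lambda>_def)
  define X where "X = gauss_op ?MI w 1 (top_exp \<Lambda>) (\<lambda>_. 0)"
  have X: "(\<integral>\<^sup>+ y. ennreal (exp (\<Lambda> * Max ((\<lambda>u. inner_tensor k n y (tensor_power k (v u))) ` {..<m})))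
      \<partial>std_gauss_PiM ?MI) = X"
  proof -
    have "(\<Sum>i\<in>?MI. y i * w i u) = inner_tensor k n y (tensor_power k (v u))" for y u
      unfolding inner_tensor_def by (intro sum.cong) (use i0 in \<open>auto simp: w_def\<close>)
    then show ?thesis by (simp add: X_def gauss_op_def top_exp_def)
  qed
  have "gauss_op (insert i0 ?MI) w 1 (top_exp \<Lambda>) (\<lambda>_. 0)
      = (\<integral>\<^sup>+ t. gauss_op ?MI w 1 (top_exp \<Lambda>) (\<lambda>_. t * sqrt (real (k - 1))) \<partial>std_gauss)"
    by (simp add: gauss_op_insert[OF finite_multi_indices i0 measurable_top_exp]
        gauss_op_singleton measurable_gauss_op measurable_top_exp w_def)
  also have "\<dots> = (\<integral>\<^sup>+ t. X * ennreal (exp ((\<Lambda> * sqrt (real (k - 1))) * t)) \<partial>std_gauss)"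
  proof -
    \<comment> \<open>A shift common to all points leaves the maximum as a summand, so the extra
      noise integrates to an explicit factor.\<close>
    have "top_exp \<Lambda> (\<lambda>u. t + f u) = ennreal (exp (\<Lambda> * t)) * top_exp \<Lambda> f" for t f
    proof -
      have "Max ((\<lambda>u. t + f u) ` {..<m}) = Max (f ` {..<m}) + t"
        using m by (subst Max_add_commute[symmetric]) (auto simp: add.commute)
      then show ?thesis
        by (simp add: top_exp_def algebra_simps exp_add flip: ennreal_mult)
    qed
    then have "gauss_op ?MI w 1 (top_exp \<Lambda>) (\<lambda>_. t)
        = gauss_op ?MI w 1 (\<lambda>x. ennreal (exp (\<Lambda> * t)) * top_exp \<Lambda> x) (\<lambda>_. 0)" for t
      by (simp add: gauss_op_def)
    also have "gauss_op ?MI w 1 (\<lambda>x. ennreal (exp (\<Lambda> * t)) * top_exp \<Lambda> x) (\<lambda>_. 0) = ennreal (exp (\<Lambda> * t)) * X" for t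
      unfolding X_def by (rule gauss_op_cmult[OF finite_multi_indices measurable_top_exp])
    finally show ?thesis by (simp add: mult_ac)
  qed
  also have "\<dots> = X * ennreal (exp (\<Lambda>\<^sup>2 * real (k - 1) / 2))"
    by (subst nn_integral_cmult) (simp_all add: nn_integral_std_gauss_exp power_mult_distrib)
  finally have LHS: "gauss_op (insert i0 ?MI) w 1 (top_exp \<Lambda>) (\<lambda>_. 0)
      = X * ennreal (exp (real n * l\<^sup>2 * real (k - 1) / 2))"
    by (simp add: \<Lambda>_def power_mult_distrib)
  \<comment> \<open>The free parameter of the square completion below. Since \<open>L > l\<close>,
    the coefficient \<open>l / (2 * L)\<close> stays below 1/2 and the Gaussian integral of the
    squared norm is finite.\<close>
  define L where "L = l + c"
  have L: "L > 0" "l / L < 1" using l c by (auto simp: L_def)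
  have "gauss_op {..<n} w' 1 (top_exp \<Lambda>) (\<lambda>_. 0)
      \<le> (\<integral>\<^sup>+ y. ennreal (exp (l * real n * real k * L / 2)) * ennreal (exp (l / (2 * L) * (\<Sum>j<n. (y j)\<^sup>2)))
          \<partial>std_gauss_PiM {..<n})"
    unfolding gauss_op_def
  proof (rule nn_integral_mono)
    fix y :: "nat \<Rightarrow> real"
    let ?f = "\<lambda>u. 0 + 1 * (\<Sum>j<n. y j * w' j u)"
    have "\<Lambda> * ?f u \<le> l * real n * real k * L / 2 + l / (2 * L) * (\<Sum>j<n. (y j)\<^sup>2)" if "u < m" for u
    proof -
      let ?r = "sqrt (real n * real k)"
      \<comment> \<open>Bounds the linear form on the unit sphere by a multiple of the squared norm
        of \<open>y\<close> plus a constant, uniformly in \<open>u\<close>.\<close>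
      have "0 \<le> (\<Sum>j<n. (y j - L * ?r * v u j)\<^sup>2)" by (rule sum_nonneg) simp
      also have "\<dots> = (\<Sum>j<n. (y j)\<^sup>2) + L\<^sup>2 * ?r\<^sup>2 * inner_vec n (v u) (v u) - 2 * L * ?r * (\<Sum>j<n. y j * v u j)"
        by (simp add: power2_diff power_mult_distrib inner_vec_def sum.distrib sum_subtractf
            sum_distrib_left mult_ac power2_eq_square[of "v u _"])
      finally have *: "2 * L * ?r * (\<Sum>j<n. y j * v u j) \<le> (\<Sum>j<n. (y j)\<^sup>2) + L\<^sup>2 * (real n * real k)"
        by (simp add: inner_vec_unit_sphere[OF v[OF that]])
      have "\<Lambda> * ?f u = l / (2 * L) * (2 * L * ?r * (\<Sum>j<n. y j * v u j))"
        using L by (simp add: \<Lambda>_def w'_def real_sqrt_mult sum_distrib_left mult_ac)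
      also have "\<dots> \<le> l / (2 * L) * ((\<Sum>j<n. (y j)\<^sup>2) + L\<^sup>2 * (real n * real k))"
        using * l L by (intro mult_left_mono) auto
      also have "\<dots> = l * real n * real k * L / 2 + l / (2 * L) * (\<Sum>j<n. (y j)\<^sup>2)"
        using L by (simp add: field_simps power2_eq_square)
      finally show ?thesis .
    qed
    moreover have "Max (?f ` {..<m}) \<in> ?f ` {..<m}" using m by (intro Max_in) auto
    ultimately have "\<Lambda> * Max (?f ` {..<m}) \<le> l * real n * real k * L / 2 + l / (2 * L) * (\<Sum>j<n. (y j)\<^sup>2)"
      by fastforce
    then show "top_exp \<Lambda> ?f
        \<le> ennreal (exp (l * real n * real k * L / 2)) * ennreal (exp (l / (2 * L) * (\<Sum>j<n. (y j)\<^sup>2)))"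
      by (simp add: top_exp_def ennreal_leI flip: ennreal_mult exp_add)
  qed
  also have "\<dots> = ennreal (exp (l * real n * real k * L / 2)) * ennreal ((1 - l / L) powr (- real n / 2))"
    using L nn_integral_std_gauss_PiM_exp_square[of "{..<n}" "l / (2 * L)"]
    by (subst nn_integral_cmult) (simp_all add: field_simps)
  also have "(1 - l / L) powr (- real n / 2) = exp (real n / 2 * ln (1 + l / c))"
  proof -
    have "1 - l / L = inverse (1 + l / c)" using l c by (simp add: L_def field_simps)
    then have "ln (1 - l / L) = - ln (1 + l / c)" using l c by (simp only: ln_inverse)
    then show ?thesis using L by (simp add: powr_def)
  qed
  also have "ennreal (exp (l * real n * real k * L / 2)) * ennreal (exp (real n / 2 * ln (1 + l / c)))
      = ennreal (exp (l * real n * real k * L / 2 + real n / 2 * ln (1 + l / c)))"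
    by (simp add: exp_add ennreal_mult)
  finally have "X * ennreal (exp (real n * l\<^sup>2 * real (k - 1) / 2))
      \<le> ennreal (exp (l * real n * real k * L / 2 + real n / 2 * ln (1 + l / c)))"
    using gauss_op_top_exp_le[OF \<Lambda>, of "\<lambda>_. 0"] LHS by simp
  \<comment> \<open>Removes the factor contributed by the common noise.\<close>
  then have "X * ennreal (exp (real n * l\<^sup>2 * real (k - 1) / 2)) * ennreal (exp (- (real n * l\<^sup>2 * real (k - 1) / 2)))
      \<le> ennreal (exp (l * real n * real k * L / 2 + real n / 2 * ln (1 + l / c)))
        * ennreal (exp (- (real n * l\<^sup>2 * real (k - 1) / 2)))"
    by (rule mult_right_mono) simp
  moreover have "ennreal (exp r) * ennreal (exp (- r)) = 1" for r
    by (simp flip: ennreal_mult exp_add)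
  moreover have "ennreal (exp r) * ennreal (exp (- r')) = ennreal (exp (r - r'))" for r r'
    by (simp flip: ennreal_mult exp_add)
  ultimately have "X \<le> ennreal (exp (l * real n * real k * L / 2 + real n / 2 * ln (1 + l / c) - real n * l\<^sup>2 * real (k - 1) / 2))"
    by (simp only: mult.assoc mult_1_right)
  also have "l * real n * real k * L / 2 + real n / 2 * ln (1 + l / c) - real n * l\<^sup>2 * real (k - 1) / 2
      = real n / 2 * (l\<^sup>2 + l * c * real k + ln (1 + l / c))"
    using k by (simp add: L_def of_nat_diff field_simps power2_eq_square)
  finally show ?thesis
    using X by (simp add: \<Lambda>_def)
qed

section \<open>The constant \<open>mu\<close>\<close>

text \<open>The difference of the two sides vanishes at 1 and has derivative
  \<open>(x - 1)^2 / (x * (x + 1)^2)\<close>. With \<open>t = k - 1\<close> it gives the sign of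
  \<open>h_fun\<close> at the right end of its interval.\<close>

lemma ln_ge_pade:
  fixes t :: real
  assumes "t \<ge> 1"
  shows "ln t \<ge> 2 * (t - 1) / (t + 1)"
proof -
  have "(\<lambda>t. ln t + 4 / (t + 1)) 1 \<le> (\<lambda>t. ln t + 4 / (t + 1)) t"
  proof (rule DERIV_nonneg_imp_nondecreasing[OF assms])
    fix x :: real assume x: "1 \<le> x" "x \<le> t"
    have "((\<lambda>t. ln t + 4 / (t + 1)) has_real_derivative 1 / x - 4 / (x + 1)\<^sup>2) (at x)"
      using x by (auto intro!: derivative_eq_intros simp: power2_eq_square)
    moreover have "4 / (x + 1)\<^sup>2 \<le> 1 / x"
    proof -
      have "0 \<le> (x - 1)\<^sup>2" by simp
      then have "4 * x \<le> (x + 1)\<^sup>2" by (simp add: power2_eq_square algebra_simps)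
      then show ?thesis using x by (simp add: divide_le_eq le_divide_eq mult.commute)
    qed
    ultimately show "\<exists>y. ((\<lambda>t. ln t + 4 / (t + 1)) has_real_derivative y) (at x) \<and> 0 \<le> y"
      by force
  qed
  moreover have "2 * (t - 1) / (t + 1) = 2 - 4 / (t + 1)"
    using assms by (simp add: field_simps)
  ultimately show ?thesis by simp
qed

text \<open>Twice \<open>g_fun\<close> in the variable \<open>w = k * z^2 / 2\<close>, where the
  square root disappears.\<close>

definition h_fun :: "nat \<Rightarrow> real \<Rightarrow> real" where
  "h_fun k w = (2 - real k) / real k - ln w + (real k - 1) / real k * w - 1 / (real k * w)"

text \<open>The derivative factors as \<open>(1 - (k - 1) * x) * (1 - x) / (k * x^2)\<close>, and
  both factors of the numerator are positive strictly inside the interval.\<close>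

lemma h_fun_strict_mono:
  assumes k: "k \<ge> 2" and w: "0 < w1" "w1 < w2" "w2 \<le> 1 / (real k - 1)"
  shows "h_fun k w1 < h_fun k w2"
proof (rule DERIV_pos_imp_increasing_open[OF w(2)])
  fix x assume x: "w1 < x" "x < w2"
  have "(h_fun k has_real_derivative (1 - (real k - 1) * x) * (1 - x) / (real k * x\<^sup>2)) (at x)"
    unfolding h_fun_def[abs_def] using x w k
    by (auto intro!: derivative_eq_intros simp: field_simps power2_eq_square)
  moreover have "(real k - 1) * x < 1"
  proof -
    have "x < 1 / (real k - 1)" using x w by linarith
    moreover have "0 < real k - 1" using k by simp
    ultimately have "x * (real k - 1) < 1" by (simp only: pos_less_divide_eq)
    then show ?thesis by (simp only: mult.commute)
  qed
  moreover have "x < 1"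
  proof -
    have "1 / (real k - 1) \<le> 1" using k by simp
    then show ?thesis using x w by linarith
  qed
  ultimately show "\<exists>y. (h_fun k has_real_derivative y) (at x) \<and> 0 < y"
    using x w k by (intro exI[of _ "(1 - (real k - 1) * x) * (1 - x) / (real k * x\<^sup>2)"]) auto
next
  show "continuous_on {w1..w2} (h_fun k)"
    unfolding h_fun_def[abs_def] using w k by (auto intro!: continuous_intros)
qed

lemma h_fun_root:
  assumes k: "k \<ge> 2"
  obtains w where "0 < w" "w \<le> 1 / (real k - 1)" "h_fun k w = 0"
proof -
  \<comment> \<open>At \<open>?w0\<close> the term \<open>- 1 / (k * w)\<close> equals
    \<open>- k^2\<close> and outweighs the logarithm, so the intermediate value theorem applies
    between \<open>?w0\<close> and the right end \<open>?w1\<close>.\<close>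
  let ?w0 = "1 / real k ^ 3" and ?w1 = "1 / (real k - 1)"
  have "real k \<ge> 2" using k by simp
  have "h_fun k ?w0 = (2 - real k) / real k + 3 * ln (real k) + (real k - 1) / real k ^ 4 - (real k)\<^sup>2"
  proof -
    have "ln ?w0 = - 3 * ln (real k)" using k by (simp add: ln_div ln_realpow)
    moreover have "(real k - 1) / real k * ?w0 = (real k - 1) / real k ^ 4"
      by (simp add: eval_nat_numeral)
    moreover have "1 / (real k * ?w0) = (real k)\<^sup>2"
      using k by (simp add: eval_nat_numeral)
    ultimately show ?thesis by (simp only: h_fun_def)
  qed
  also have "\<dots> \<le> 0 + 3 * (real k - 1) + 1 / 2 - (real k)\<^sup>2"
  proof -
    have "(2 - real k) / real k \<le> 0" using k by (simp add: divide_le_0_iff)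
    moreover have "ln (real k) \<le> real k - 1" using k by (intro ln_le_minus_one) auto
    moreover have "(real k - 1) / real k ^ 4 \<le> 1 / 2"
    proof -
      have "2 ^ 3 \<le> real k ^ 3" using \<open>real k \<ge> 2\<close> by (intro power_mono) auto
      then have "real k * 2 \<le> real k * real k ^ 3" by (intro mult_left_mono) auto
      moreover have "2 * (real k - 1) \<le> real k * 2" by simp
      ultimately have "2 * (real k - 1) \<le> real k * real k ^ 3" by (rule order_trans[rotated])
      also have "\<dots> = real k ^ 4" by (simp add: eval_nat_numeral)
      finally have "2 * (real k - 1) \<le> real k ^ 4" .
      then show ?thesis using k by (simp add: pos_divide_le_eq)
    qed
    moreover have "a + 3 * b + c - d \<le> 0 + 3 * e + 1 / 2 - d"
      if "a \<le> 0" "b \<le> e" "c \<le> 1 / 2" for a b c d e :: real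
      using that by linarith
    ultimately show ?thesis by blast
  qed
  also have "\<dots> \<le> 0"
  proof -
    \<comment> \<open>The bound to be checked equals \<open>- (k - 3 / 2)^2 - 1 / 4\<close>.\<close>
    have "0 \<le> (real k - 3 / 2)\<^sup>2" by simp
    then show ?thesis by (simp add: power2_eq_square algebra_simps)
  qed
  finally have 0: "h_fun k ?w0 \<le> 0" .
  have "h_fun k ?w1 = ln (real k - 1) - 2 * ((real k - 1) - 1) / ((real k - 1) + 1)"
    using \<open>real k \<ge> 2\<close> by (simp add: h_fun_def ln_div field_simps)
  also have "\<dots> \<ge> 0" using ln_ge_pade[of "real k - 1"] k by simp
  finally have 1: "0 \<le> h_fun k ?w1" .
  have le: "?w0 \<le> ?w1"
  proof -
    have "real k - 1 \<le> real k" by simp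
    also have "\<dots> \<le> real k ^ 3" using k by (intro self_le_power) auto
    finally have "real k - 1 \<le> real k ^ 3" .
    from divide_left_mono[OF this, of 1] show ?thesis using \<open>real k \<ge> 2\<close> by simp
  qed
  have "?w0 > 0" using k by simp
  then have "continuous_on {?w0..?w1} (h_fun k)"
    unfolding h_fun_def[abs_def] using k by (auto intro!: continuous_intros)
  from IVT'[OF 0 1 le this] obtain w where "?w0 \<le> w" "w \<le> ?w1" "h_fun k w = 0" by blast
  with \<open>?w0 > 0\<close> show thesis by (intro that[of w]) linarith+
qed

lemma eta_pos: "k \<ge> 2 \<Longrightarrow> eta k > 0"
  by (simp add: eta_def)

text \<open>The substitution \<open>w = k * z\<^sup>2 / 2\<close>, \<open>x = 1 / sqrt w + (k - 1) * sqrt w\<close> maps \<open>[eta k, \<infinity>)\<close>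
  bijectively to \<open>(0, 1 / (k - 1)]\<close> and turns \<open>g_fun k\<close> into \<open>h_fun k / 2\<close>.\<close>

lemma g_fun_eq_h_fun:
  assumes k: "k \<ge> 2" and x: "x \<ge> eta k"
  defines "y \<equiv> (x - sqrt (x\<^sup>2 - 4 * (real k - 1))) / (2 * (real k - 1))"
  shows "y > 0" "y\<^sup>2 \<le> 1 / (real k - 1)" "x = 1 / y + (real k - 1) * y" "g_fun k x = h_fun k (y\<^sup>2) / 2"
proof -
  have k1: "real k - 1 > 0" using k by simp
  have x0: "x > 0" using eta_pos[OF k] x by simp
  have "(eta k)\<^sup>2 \<le> x\<^sup>2" using x k1 by (intro power_mono) (auto simp: eta_def)
  then have d: "x\<^sup>2 - 4 * (real k - 1) \<ge> 0" using k1 by (simp add: eta_def power_mult_distrib)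
  define r where "r = sqrt (x\<^sup>2 - 4 * (real k - 1))"
  have r: "r \<ge> 0" "r\<^sup>2 = x\<^sup>2 - 4 * (real k - 1)" using d by (auto simp: r_def)
  have "r < x" using r x0 k1 by (smt (verit) power2_less_imp_less)
  have y: "y = (x - r) / (2 * (real k - 1))" by (simp add: y_def r_def)
  have nz: "2 * (real k - 1) \<noteq> 0" using k1 by simp
  have ky: "y * (2 * (real k - 1)) = x - r"
    by (rule nonzero_eq_divide_eq[OF nz, THEN iffD1, OF y])
  show y0: "y > 0" using \<open>r < x\<close> k1 by (simp add: y)
  \<comment> \<open>\<open>y\<close> is the smaller root of
    \<open>(k - 1) * y^2 - x * y + 1 = 0\<close>; multiplying by the conjugate gives its
    reciprocal.\<close>
  have prod: "(x - r) * (x + r) = 4 * (real k - 1)" using r(2) by (simp add: algebra_simps power2_eq_square)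
  have inv: "1 / y = (x + r) / 2"
    using prod \<open>r < x\<close> k1 y0 by (simp add: y field_simps)
  show x_eq: "x = 1 / y + (real k - 1) * y"
    unfolding inv using ky by (simp add: field_simps)
  show "y\<^sup>2 \<le> 1 / (real k - 1)"
  proof -
    have "(real k - 1) * y \<le> 1 / y" unfolding inv using ky r(1) by (simp add: algebra_simps)
    then have "(real k - 1) * y * y \<le> 1" using y0 by (simp add: field_simps)
    then show ?thesis using k1 by (simp add: field_simps power2_eq_square)
  qed
  define z where "z = 1 / ((real k - 1) * sqrt (2 * real k)) * (x - r)"
  have "z = 2 * y / sqrt (2 * real k)" using k1 by (simp add: z_def y field_simps)
  then have z2: "z\<^sup>2 = 2 * y\<^sup>2 / real k" using k by (simp add: power_divide power_mult_distrib)
  have "g_fun k x = 1 / 2 * ((2 - real k) / real k - ln (real k * z\<^sup>2 / 2)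
      + (real k - 1) / 2 * z\<^sup>2 - 2 / ((real k)\<^sup>2 * z\<^sup>2))"
    by (simp add: g_fun_def z_def r_def Let_def)
  also have "real k * z\<^sup>2 / 2 = y\<^sup>2" using k by (simp add: z2)
  also have "(real k - 1) / 2 * z\<^sup>2 = (real k - 1) / real k * y\<^sup>2" by (simp add: z2)
  also have "2 / ((real k)\<^sup>2 * z\<^sup>2) = 1 / (real k * y\<^sup>2)"
  proof -
    have "(real k)\<^sup>2 * z\<^sup>2 = 2 * (real k * y\<^sup>2)"
      unfolding z2 using k by (simp add: power2_eq_square[of "real k"])
    then show ?thesis by simp
  qed
  finally show "g_fun k x = h_fun k (y\<^sup>2) / 2" by (simp add: h_fun_def)
qed

text \<open>Justifies the definite description in \<open>mu\<close>: existence and uniqueness of the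
  root are carried over from \<open>h_fun\<close>.\<close>

lemma mu_root:
  assumes k: "k \<ge> 2"
  shows "mu k \<ge> eta k" "g_fun k (mu k) = 0"
proof -
  have k1: "real k - 1 > 0" using k by simp
  obtain w where w: "0 < w" "w \<le> 1 / (real k - 1)" "h_fun k w = 0"
    using h_fun_root[OF k] .
  have "\<exists>!x. x \<ge> eta k \<and> g_fun k x = 0"
  proof (rule ex_ex1I)
    define y where "y = sqrt w"
    have y: "y > 0" "y\<^sup>2 = w" using w by (auto simp: y_def)
    define x where "x = 1 / y + (real k - 1) * y"
    have "(real k - 1) * y\<^sup>2 \<le> 1" using w k1 by (simp add: y field_simps)
    then have d: "1 / y - (real k - 1) * y \<ge> 0" using y by (simp add: field_simps power2_eq_square)
    \<comment> \<open>The radicand is a perfect square. By \<open>d\<close>, which uses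
      \<open>w \<le> 1 / (k - 1)\<close>, its root has the sign that recovers \<open>y\<close> from
      \<open>x\<close>.\<close>
    have sq: "x\<^sup>2 - 4 * (real k - 1) = (1 / y - (real k - 1) * y)\<^sup>2"
      using y(1) by (simp add: x_def field_simps power2_eq_square)
    have "x > 0" using y k1 by (auto simp: x_def intro!: add_pos_pos)
    have eta_x: "(eta k)\<^sup>2 \<le> x\<^sup>2"
      using k1 zero_le_power2[of "1 / y - (real k - 1) * y"] unfolding sq[symmetric]
      by (simp add: eta_def power_mult_distrib)
    have ge: "eta k \<le> x" using \<open>x > 0\<close> by (intro power2_le_imp_le[OF eta_x]) simp
    have "(x - sqrt (x\<^sup>2 - 4 * (real k - 1))) / (2 * (real k - 1)) = y"
    proof -
      have "2 * (real k - 1) \<noteq> 0" using k1 by simp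
      moreover have "x - sqrt (x\<^sup>2 - 4 * (real k - 1)) = y * (2 * (real k - 1))"
        unfolding sq using d by (simp add: x_def)
      ultimately show ?thesis by (metis nonzero_mult_div_cancel_right)
    qed
    then have "g_fun k x = 0"
      using g_fun_eq_h_fun(4)[OF k ge] w(3) y(2) by simp
    with ge show "\<exists>x. x \<ge> eta k \<and> g_fun k x = 0" by blast
  next
    fix x1 x2 assume "x1 \<ge> eta k \<and> g_fun k x1 = 0" and "x2 \<ge> eta k \<and> g_fun k x2 = 0"
    then have x1: "x1 \<ge> eta k" "g_fun k x1 = 0" and x2: "x2 \<ge> eta k" "g_fun k x2 = 0" by auto
    obtain y1 where y1: "y1 > 0" "y1\<^sup>2 \<le> 1 / (real k - 1)" "x1 = 1 / y1 + (real k - 1) * y1" "h_fun k (y1\<^sup>2) = 0"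
      using g_fun_eq_h_fun[OF k x1(1)] x1(2) by auto
    obtain y2 where y2: "y2 > 0" "y2\<^sup>2 \<le> 1 / (real k - 1)" "x2 = 1 / y2 + (real k - 1) * y2" "h_fun k (y2\<^sup>2) = 0"
      using g_fun_eq_h_fun[OF k x2(1)] x2(2) by auto
    have "y1\<^sup>2 = y2\<^sup>2"
    proof (rule linorder_cases[of "y1\<^sup>2" "y2\<^sup>2"])
      assume "y1\<^sup>2 < y2\<^sup>2"
      with h_fun_strict_mono[OF k _ this y2(2)] y1 y2 show ?thesis by simp
    next
      assume "y2\<^sup>2 < y1\<^sup>2"
      with h_fun_strict_mono[OF k _ this y1(2)] y1 y2 show ?thesis by simp
    qed
    then have "y1 = y2" using y1 y2 by (simp add: power2_eq_iff)
    then show "x1 = x2" using y1 y2 by simp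
  qed
  from theI'[OF this] show "mu k \<ge> eta k" "g_fun k (mu k) = 0"
    unfolding mu_def by auto
qed

lemma mu_pos: "k \<ge> 2 \<Longrightarrow> mu k > 0"
  using mu_root(1)[of k] eta_pos[of k] by simp

text \<open>\<open>l\<close> and \<open>c\<close> are the stationary parameters of the bound in \<open>exp_moment_max_tensor\<close>, in the sense
  that \<open>mu k / sqrt k\<close> is the minimum of \<open>(l + c * k + ln (1 + l / c) / l) / 2\<close>.\<close>

lemma mu_parameters:
  assumes k: "k \<ge> 2"
  obtains l c where "l \<ge> 0" "c > 0" "real k * c * (c + l) = 1" "mu k / sqrt (real k) = l + real k * c"
    "l * (l + real k * c) = ln ((c + l) / c)"
proof -
  have k1: "real k - 1 > 0" "real k > 0" using k by auto
  obtain y where y: "y > 0" "y\<^sup>2 \<le> 1 / (real k - 1)" "mu k = 1 / y + (real k - 1) * y" "h_fun k (y\<^sup>2) = 0"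
    using g_fun_eq_h_fun[OF k mu_root(1)[OF k]] mu_root(2)[OF k] by auto
  define s where "s = sqrt (real k)"
  have s: "s > 0" "real k = s * s" using k by (auto simp: s_def)
  define c where "c = y / s"
  \<comment> \<open>Chosen so that \<open>k * c * (c + l) = 1\<close>, the vanishing of the
    derivative in \<open>c\<close>. For \<open>k = 2\<close> it gives \<open>l = 0\<close>, hence
    the weak inequality in the conclusion.\<close>
  define l where "l = 1 / (real k * c) - c"
  have c: "c > 0" using y s by (simp add: c_def)
  have w: "y\<^sup>2 = real k * c\<^sup>2" using s by (simp add: c_def power_divide power2_eq_square)
  have "l \<ge> 0"
  proof -
    have "1 / (real k - 1) \<le> 1" using k by simp
    then have "y\<^sup>2 \<le> 1" using y(2) by linarith
    then show ?thesis using c k1 w by (simp add: l_def field_simps power2_eq_square)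
  qed
  moreover have cl: "c + l = 1 / (real k * c)" by (simp add: l_def)
  then have "real k * c * (c + l) = 1" using c k1 by simp
  moreover have "mu k / sqrt (real k) = l + real k * c"
    unfolding y(3) l_def s_def[symmetric] using s y by (simp add: c_def field_simps s(2))
  \<comment> \<open>The root equation of \<open>h_fun\<close> becomes stationarity in
    \<open>l\<close>, multiplied by \<open>l^2\<close>.\<close>
  moreover have "l * (l + real k * c) = ln ((c + l) / c)"
  proof -
    have "(c + l) / c = 1 / y\<^sup>2" unfolding w cl using c by (simp add: power2_eq_square)
    then have "ln ((c + l) / c) = - ln (y\<^sup>2)" using y(1) by (simp add: ln_div)
    also have "\<dots> = (real k - 2) / real k - (real k - 1) / real k * y\<^sup>2 + 1 / (real k * y\<^sup>2)"
      using y(4) by (simp add: h_fun_def diff_divide_distrib)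
    also have "\<dots> = l * (l + real k * c)"
      unfolding w l_def using c k1 by (simp add: field_simps power2_eq_square)
    finally show ?thesis by simp
  qed
  ultimately show thesis using c by (intro that) auto
qed

section \<open>Tail bounds\<close>

context
  fixes M :: "'a measure" and G :: "'a \<Rightarrow> (nat \<Rightarrow> nat) \<Rightarrow> real" and k n :: nat
  assumes M: "prob_space M" and iid: "iid_std_normal_tensor M k n G" and k: "k \<ge> 2" and n: "n \<ge> 1"
begin

interpretation prob_space M by (rule M)

section \<open>From the random tensor to the product measure, and deviation probabilities\<close>

lemma measurable_G [measurable]:
  assumes "i \<in> multi_indices k n"
  shows "(\<lambda>\<omega>. G \<omega> i) \<in> borel_measurable M"
  using iid assms by (auto simp: iid_std_normal_tensor_def distributed_def)

lemma measurable_inner_tensor [measurable]: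
  "(\<lambda>\<omega>. inner_tensor k n (G \<omega>) T) \<in> borel_measurable M"
  unfolding inner_tensor_def
  by (intro borel_measurable_sum borel_measurable_times measurable_G) auto

text \<open>Independence makes the joint law of the entries a product measure. The restriction is
  needed because functions in the product space are \<open>undefined\<close> off the index
  set.\<close>

lemma nn_integral_iid_tensor:
  assumes [measurable]: "f \<in> borel_measurable (std_gauss_PiM (multi_indices k n))"
  shows "(\<integral>\<^sup>+ \<omega>. f (restrict (G \<omega>) (multi_indices k n)) \<partial>M) = (\<integral>\<^sup>+ y. f y \<partial>std_gauss_PiM (multi_indices k n))"
proof -
  let ?MI = "multi_indices k n"
  have "(\<lambda>_\<in>{..<k}. 0) \<in> ?MI" using n by (auto simp: multi_indices_def)
  then have ne: "?MI \<noteq> {}" by blast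
  have sets: "sets (std_gauss_PiM ?MI) = sets (PiM ?MI (\<lambda>_. borel))"
    by (intro sets_PiM_cong) simp_all
  have "distr M (PiM ?MI (\<lambda>_. borel)) (\<lambda>\<omega>. \<lambda>i\<in>?MI. G \<omega> i) = PiM ?MI (\<lambda>i. distr M borel (\<lambda>\<omega>. G \<omega> i))"
    using indep_vars_iff_distr_eq_PiM'[OF ne, where M' = "\<lambda>_. borel" and X = "\<lambda>i \<omega>. G \<omega> i"] iid
    by (auto simp: iid_std_normal_tensor_def)
  also have "\<dots> = std_gauss_PiM ?MI"
  proof (rule PiM_cong[OF refl])
    fix i assume "i \<in> ?MI"
    then have "distributed M lborel (\<lambda>\<omega>. G \<omega> i) std_normal_density"
      using iid by (simp add: iid_std_normal_tensor_def)
    then show "distr M borel (\<lambda>\<omega>. G \<omega> i) = std_gauss"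
      using distr_cong[OF refl sets_lborel refl, of M "\<lambda>\<omega>. G \<omega> i"] by (simp add: distributed_def)
  qed
  finally have D: "distr M (PiM ?MI (\<lambda>_. borel)) (\<lambda>\<omega>. \<lambda>i\<in>?MI. G \<omega> i) = std_gauss_PiM ?MI" .
  have "(\<lambda>\<omega>. \<lambda>i\<in>?MI. G \<omega> i) \<in> M \<rightarrow>\<^sub>M PiM ?MI (\<lambda>_. borel)"
    by (intro measurable_restrict measurable_G)
  moreover have "f \<in> borel_measurable (PiM ?MI (\<lambda>_. borel))"
    using assms measurable_cong_sets[OF sets refl] by blast
  ultimately show ?thesis
    unfolding D[symmetric] by (simp add: nn_integral_distr)
qed

lemma inner_tensor_restrict: "inner_tensor k n (restrict S (multi_indices k n)) T = inner_tensor k n S T"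
  by (simp add: inner_tensor_def)

lemma measurable_inner_tensor_PiM [measurable]:
  "(\<lambda>y. inner_tensor k n y T) \<in> borel_measurable (std_gauss_PiM (multi_indices k n))"
proof -
  have "(\<lambda>y. y i) \<in> borel_measurable (std_gauss_PiM (multi_indices k n))" if "i \<in> multi_indices k n" for i
    using measurable_component_singleton[OF that, of "\<lambda>_. std_gauss"] by simp
  then show ?thesis
    unfolding inner_tensor_def by (intro borel_measurable_sum borel_measurable_times) auto
qed

lemma chernoff:
  assumes [measurable]: "X \<in> borel_measurable M" and "l > 0"
    and bound: "(\<integral>\<^sup>+ \<omega>. ennreal (exp (l * X \<omega>)) \<partial>M) \<le> ennreal (exp b)"
  shows "prob {\<omega> \<in> space M. X \<omega> > t} \<le> exp (b - l * t)"
proof -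
  have "emeasure M {\<omega> \<in> space M. X \<omega> > t}
      \<le> emeasure M {\<omega> \<in> space M. 1 \<le> ennreal (exp (- (l * t))) * ennreal (exp (l * X \<omega>))}"
    using \<open>l > 0\<close> by (intro emeasure_mono) (auto simp flip: ennreal_mult exp_add)
  also have "\<dots> \<le> ennreal (exp (- (l * t))) * (\<integral>\<^sup>+ \<omega>. ennreal (exp (l * X \<omega>)) * indicator (space M) \<omega> \<partial>M)"
    by (rule nn_integral_Markov_inequality) measurable
  also have "\<dots> = ennreal (exp (- (l * t))) * (\<integral>\<^sup>+ \<omega>. ennreal (exp (l * X \<omega>)) \<partial>M)"
    by (intro arg_cong2[where f = "(*)"] refl nn_integral_cong) simp
  also have "\<dots> \<le> ennreal (exp (- (l * t))) * ennreal (exp b)"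
    using bound by (rule mult_left_mono) simp
  also have "\<dots> = ennreal (exp (b - l * t))"
    by (simp flip: ennreal_mult exp_add)
  finally show ?thesis
    by (simp add: emeasure_eq_measure)
qed

text \<open>A tensor power of a unit vector has norm 1, so its inner product with \<open>G\<close>
  is standard normal; the Chernoff parameter is \<open>r\<close> itself.\<close>

lemma lower_tail_fixed_vector:
  assumes v: "v \<in> unit_sphere n" and r: "r > 0"
  shows "prob {\<omega> \<in> space M. inner_tensor k n (G \<omega>) (tensor_power k v) < - r} \<le> exp (- r\<^sup>2 / 2)"
proof -
  let ?MI = "multi_indices k n"
  let ?X = "\<lambda>\<omega>. - inner_tensor k n (G \<omega>) (tensor_power k v)"
  have "(\<integral>\<^sup>+ \<omega>. ennreal (exp (r * ?X \<omega>)) \<partial>M)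
      = (\<integral>\<^sup>+ \<omega>. ennreal (exp (r * - inner_tensor k n (restrict (G \<omega>) ?MI) (tensor_power k v))) \<partial>M)"
    by (simp add: inner_tensor_restrict)
  also have "\<dots> = (\<integral>\<^sup>+ y. ennreal (exp (r * - inner_tensor k n y (tensor_power k v))) \<partial>std_gauss_PiM ?MI)"
    by (rule nn_integral_iid_tensor) measurable
  also have "\<dots> = (\<integral>\<^sup>+ y. ennreal (exp (\<Sum>i\<in>?MI. (- r * tensor_power k v i) * y i)) \<partial>std_gauss_PiM ?MI)"
    by (simp add: inner_tensor_def sum_distrib_left sum_negf mult_ac)
  also have "\<dots> = ennreal (exp ((\<Sum>i\<in>?MI. (- r * tensor_power k v i)\<^sup>2) / 2))"
    by (rule nn_integral_std_gauss_PiM_exp) simp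
  also have "(\<Sum>i\<in>?MI. (- r * tensor_power k v i)\<^sup>2) = r\<^sup>2 * inner_tensor k n (tensor_power k v) (tensor_power k v)"
    by (simp add: inner_tensor_def sum_distrib_left power_mult_distrib power2_eq_square[of "tensor_power _ _ _"])
  also have "\<dots> = r\<^sup>2"
    by (simp add: inner_tensor_power inner_vec_unit_sphere[OF v])
  finally have "(\<integral>\<^sup>+ \<omega>. ennreal (exp (r * ?X \<omega>)) \<partial>M) \<le> ennreal (exp (r\<^sup>2 / 2))" by simp
  from chernoff[OF _ r this, of r] show ?thesis
    by (simp add: power2_eq_square less_minus_iff minus_less_iff)
qed

text \<open>Chernoff's bound with \<open>c\<close> stationary and \<open>l\<close> moved off its
  stationary value \<open>l0\<close> by exactly \<open>s\<close>. The zeroth- and first-order terms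
  reproduce \<open>mu k / sqrt k\<close>, and the rest is at most
  \<open>- n * s^2 / 2\<close>.\<close>

lemma upper_tail_finite:
  fixes v :: "nat \<Rightarrow> nat \<Rightarrow> real"
  assumes m: "m > 0" and v: "\<And>l. l < m \<Longrightarrow> v l \<in> unit_sphere n" and s: "s > 0"
  shows "prob {\<omega> \<in> space M. \<exists>l<m. inner_tensor k n (G \<omega>) (tensor_power k (v l))
      > sqrt (real n) * (mu k / sqrt (real k) + s)} \<le> exp (- real n * s\<^sup>2 / 2)"
proof -
  let ?MI = "multi_indices k n"
  obtain l0 c where l0: "l0 \<ge> 0" and c: "c > 0" and kc: "real k * c * (c + l0) = 1"
    and mu: "mu k / sqrt (real k) = l0 + real k * c"
    and ln0: "l0 * (l0 + real k * c) = ln ((c + l0) / c)"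
    using mu_parameters[OF k] by blast
  define l where "l = l0 + s"
  have l: "l > 0" using l0 s by (simp add: l_def)
  define X where "X y = Max ((\<lambda>u. inner_tensor k n y (tensor_power k (v u))) ` {..<m})" for y
  have X_meas: "(\<lambda>\<omega>. X (G \<omega>)) \<in> borel_measurable M"
    unfolding X_def using m by (intro borel_measurable_Max) auto
  have X_meas': "X \<in> borel_measurable (std_gauss_PiM ?MI)"
    unfolding X_def[abs_def] using m by (intro borel_measurable_Max) auto
  let ?b = "real n / 2 * (l\<^sup>2 + l * c * real k + ln (1 + l / c))"
  have "(\<integral>\<^sup>+ \<omega>. ennreal (exp (sqrt (real n) * l * X (G \<omega>))) \<partial>M)
      = (\<integral>\<^sup>+ \<omega>. ennreal (exp (sqrt (real n) * l * X (restrict (G \<omega>) ?MI))) \<partial>M)"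
    by (simp add: inner_tensor_restrict X_def)
  also have "\<dots> = (\<integral>\<^sup>+ y. ennreal (exp (sqrt (real n) * l * X y)) \<partial>std_gauss_PiM ?MI)"
    by (intro nn_integral_iid_tensor measurable_compose[OF X_meas', of "\<lambda>x. ennreal (exp (_ * x))"]) simp
  also have "\<dots> \<le> ennreal (exp ?b)"
    unfolding X_def using k n m v l c by (intro exp_moment_max_tensor) auto
  finally have "prob {\<omega> \<in> space M. X (G \<omega>) > sqrt (real n) * (mu k / sqrt (real k) + s)}
      \<le> exp (?b - sqrt (real n) * l * (sqrt (real n) * (mu k / sqrt (real k) + s)))"
    using l n by (intro chernoff X_meas) auto
  also have "\<dots> \<le> exp (- real n * s\<^sup>2 / 2)"
  proof -
    have "ln (1 + l / c) = ln ((c + l0) / c * (1 + s / (c + l0)))"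
    proof -
      have "1 + l / c = (c + l0) / c * (1 + s / (c + l0))"
      proof -
        define d where "d = c + l0"
        have "d > 0" "l = d - c + s" using c l0 by (simp_all add: d_def l_def)
        then show ?thesis unfolding d_def[symmetric] using c by (simp add: field_simps)
      qed
      then show ?thesis by simp
    qed
    also have "\<dots> = ln ((c + l0) / c) + ln (1 + s / (c + l0))"
      using c l0 s by (intro ln_mult_pos) (auto intro!: add_pos_nonneg divide_nonneg_pos)
    \<comment> \<open>The tangent bound of the concave logarithm at \<open>l0\<close>; stationarity
      in \<open>c\<close> turns its slope \<open>1 / (c + l0)\<close> into
      \<open>k * c\<close>.\<close>
    also have "ln (1 + s / (c + l0)) \<le> s / (c + l0)"
      using c l0 s by (intro ln_add_one_self_le_self) auto
    also have "s / (c + l0) = s * (real k * c)"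
    proof -
      have "1 / (c + l0) = real k * c" using kc c l0 by (simp add: field_simps)
      then show ?thesis by (simp add: divide_inverse)
    qed
    finally have "ln (1 + l / c) \<le> l0 * (l0 + real k * c) + s * (real k * c)" using ln0 by simp
    then have "?b \<le> real n / 2 * (l\<^sup>2 + l * c * real k + (l0 * (l0 + real k * c) + s * (real k * c)))"
      by (intro mult_left_mono add_left_mono) auto
    also have "\<dots> = real n * (l * (l0 + real k * c) + s\<^sup>2 / 2)"
      by (simp add: l_def field_simps power2_eq_square)
    finally have "?b - real n * (l * (l0 + real k * c + s)) \<le> real n * (s\<^sup>2 / 2 - l * s)"
      by (simp add: algebra_simps)
    \<comment> \<open>Uses \<open>l \<ge> s\<close>, that is \<open>l0 \<ge> 0\<close>.\<close>
    also have "\<dots> \<le> real n * (- s\<^sup>2 / 2)"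
      using l0 s by (intro mult_left_mono) (auto simp: l_def power2_eq_square algebra_simps)
    finally have "?b - real n * (l * (l0 + real k * c + s)) \<le> - real n * s\<^sup>2 / 2" by simp
    moreover have "sqrt (real n) * l * (sqrt (real n) * x) = real n * (l * x)" for x
    proof -
      have "sqrt (real n) * l * (sqrt (real n) * x) = (sqrt (real n) * sqrt (real n)) * (l * x)"
        by (simp only: mult_ac)
      then show ?thesis by simp
    qed
    ultimately show ?thesis by (simp only: mu exp_le_cancel_iff)
  qed
  also have "{\<omega> \<in> space M. X (G \<omega>) > sqrt (real n) * (mu k / sqrt (real k) + s)}
      = {\<omega> \<in> space M. \<exists>l<m. inner_tensor k n (G \<omega>) (tensor_power k (v l)) > sqrt (real n) * (mu k / sqrt (real k) + s)}"
    unfolding X_def using m by (subst Max_gr_iff) auto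
  finally show ?thesis .
qed

text \<open>Finite subsets exhaust a countable dense subset of the sphere, and continuity extends
  the bound to every unit vector. The exceptional event \<open>A\<close> serves all \<open>u\<close>
  at once, so a random \<open>u\<close> such as the estimator may be inserted.\<close>

lemma upper_tail_sphere:
  assumes s: "s > 0" and v0: "v\<^sub>0 \<in> unit_sphere n"
  obtains A where "A \<in> sets M" "prob A \<le> exp (- real n * s\<^sup>2 / 2)"
    and "\<And>\<omega> u. \<omega> \<in> space M - A \<Longrightarrow> u \<in> unit_sphere n \<Longrightarrow>
      inner_tensor k n (G \<omega>) (tensor_power k u) \<le> sqrt (real n) * (mu k / sqrt (real k) + s)"
proof -
  let ?t = "sqrt (real n) * (mu k / sqrt (real k) + s)"
  obtain D where D: "countable D" "D \<subseteq> unit_sphere n" "unit_sphere n \<subseteq> closure D"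
    using separable[of "unit_sphere n"] .
  have "D \<noteq> {}" using D(3) v0 by auto
  then have d: "range (from_nat_into D) = D" using D(1) by (rule range_from_nat_into)
  let ?B = "\<lambda>m. {\<omega> \<in> space M. \<exists>l<Suc m. inner_tensor k n (G \<omega>) (tensor_power k (from_nat_into D l)) > ?t}"
  have B: "?B m \<in> sets M" for m by measurable
  have "incseq ?B" by (auto simp: incseq_def) (meson less_le_trans Suc_le_mono)
  then have lim: "(\<lambda>m. prob (?B m)) \<longlonglongrightarrow> prob (\<Union>m. ?B m)"
    using B by (intro finite_Lim_measure_incseq) auto
  have le: "prob (?B m) \<le> exp (- real n * s\<^sup>2 / 2)" for m
    using D(2) d by (intro upper_tail_finite s) auto
  show thesis
  proof (rule that)
    show "(\<Union>m. ?B m) \<in> sets M" using B by blast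
    show "prob (\<Union>m. ?B m) \<le> exp (- real n * s\<^sup>2 / 2)"
      using lim by (rule LIMSEQ_le_const2) (use le in blast)
    fix \<omega> u assume \<omega>: "\<omega> \<in> space M - (\<Union>m. ?B m)" and u: "u \<in> unit_sphere n"
    have "continuous_on UNIV (\<lambda>u. inner_tensor k n (G \<omega>) (tensor_power k u))"
      unfolding inner_tensor_def tensor_power_def by (intro continuous_intros continuous_on_product_coordinates)
    then have "closed {u. inner_tensor k n (G \<omega>) (tensor_power k u) \<le> ?t}"
      by (intro closed_Collect_le continuous_on_const)
    moreover have "D \<subseteq> {u. inner_tensor k n (G \<omega>) (tensor_power k u) \<le> ?t}"
    proof
      fix u assume "u \<in> D"
      then obtain l where u: "u = from_nat_into D l" using d by (metis rangeE)
      have "\<omega> \<notin> ?B l" "\<omega> \<in> space M" using \<omega> by blast+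
      then have "\<not> inner_tensor k n (G \<omega>) (tensor_power k u) > ?t" unfolding u by blast
      then show "u \<in> {u. inner_tensor k n (G \<omega>) (tensor_power k u) \<le> ?t}" by (simp add: not_less)
    qed
    ultimately have "closure D \<subseteq> {u. inner_tensor k n (G \<omega>) (tensor_power k u) \<le> ?t}"
      by (rule closure_minimal[rotated])
    then show "inner_tensor k n (G \<omega>) (tensor_power k u) \<le> ?t" using u D(3) by blast
  qed
qed

text \<open>Optimality against \<open>v\<^sub>0\<close> bounds \<open>\<beta> * (1 - q ^ k)\<close>
  by the noise difference, where \<open>q\<close> is the overlap. Since
  \<open>\<bar>q\<bar> \<le> 1\<close>, \<open>q ^ k \<le> \<bar>q\<bar>\<close>, so the loss is at
  most \<open>2 * (1 - q ^ k)\<close>.\<close>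

lemma loss_ML_le:
  assumes v0: "v\<^sub>0 \<in> unit_sphere n" and \<beta>: "\<beta> > 0"
    and est: "is_ML_estimate k n (spiked_tensor k \<beta> v\<^sub>0 Z) v"
  shows "v \<in> unit_sphere n"
    and "loss n v v\<^sub>0 \<le> 2 / \<beta> * (inner_tensor k n Z (tensor_power k v) - inner_tensor k n Z (tensor_power k v\<^sub>0))"
proof -
  let ?Z = "\<lambda>u. inner_tensor k n Z (tensor_power k u)"
  show v: "v \<in> unit_sphere n" using est by (simp add: is_ML_estimate_def is_arg_max_def)
  have obj: "inner_tensor k n (spiked_tensor k \<beta> v\<^sub>0 Z) (tensor_power k u) = \<beta> * inner_vec n v\<^sub>0 u ^ k + ?Z u" for u
    by (simp add: spiked_tensor_def inner_tensor_def sum.distrib distrib_right sum_distrib_left mult.assoc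
        flip: inner_tensor_power)
  let ?q = "inner_vec n v v\<^sub>0"
  have "inner_vec n v\<^sub>0 v = ?q" by (simp add: inner_vec_def mult.commute)
  moreover have "\<beta> * inner_vec n v\<^sub>0 v\<^sub>0 ^ k + ?Z v\<^sub>0 \<le> \<beta> * inner_vec n v\<^sub>0 v ^ k + ?Z v"
    using est v0 unfolding is_ML_estimate_def is_arg_max_def obj by (auto simp: not_less)
  ultimately have *: "\<beta> * (1 - ?q ^ k) \<le> ?Z v - ?Z v\<^sub>0"
    by (simp add: inner_vec_unit_sphere[OF v0] algebra_simps)
  have "?q ^ k \<le> \<bar>?q\<bar> ^ k" using abs_ge_self[of "?q ^ k"] by (simp only: power_abs)
  also have "\<dots> \<le> \<bar>?q\<bar> ^ 1" using k abs_inner_vec_le_1[OF v v0] by (intro power_decreasing) auto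
  finally have "loss n v v\<^sub>0 \<le> 2 * (1 - ?q ^ k)" using loss_eq[OF v v0] by simp
  also have "\<dots> = 2 / \<beta> * (\<beta> * (1 - ?q ^ k))" using \<beta> by simp
  also have "\<dots> \<le> 2 / \<beta> * (?Z v - ?Z v\<^sub>0)" using * \<beta> by (intro mult_left_mono) auto
  finally show "loss n v v\<^sub>0 \<le> 2 / \<beta> * (?Z v - ?Z v\<^sub>0)" .
qed

lemma loss_ML_tail:
  assumes v0: "v\<^sub>0 \<in> unit_sphere n" and v_meas: "\<And>i. i < n \<Longrightarrow> (\<lambda>\<omega>. v_ML \<omega> i) \<in> borel_measurable M"
    and est: "\<And>\<omega>. \<omega> \<in> space M \<Longrightarrow> is_ML_estimate k n (spiked_tensor k \<beta> v\<^sub>0 (symmetric_noise k n (G \<omega>))) (v_ML \<omega>)"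
    and s: "s > 0" and \<beta>: "\<beta> > 0"
  shows "prob {\<omega> \<in> space M. loss n (v_ML \<omega>) v\<^sub>0 \<le> 2 / \<beta> * (mu k + s)}
    \<ge> 1 - 2 * exp (- (real n * s\<^sup>2 / (8 * real k)))"
proof -
  \<comment> \<open>After the scaling by \<open>sqrt (k / n)\<close> a deviation
    \<open>sqrt n * r\<close> amounts to \<open>s / 2\<close>: half of \<open>s\<close> goes to the
    maximum over the sphere and half to the noise at \<open>v\<^sub>0\<close>.\<close>
  define r where "r = s / (2 * sqrt (real k))"
  have r: "r > 0" using s k by (simp add: r_def)
  have r2: "r\<^sup>2 = s\<^sup>2 / (4 * real k)" by (simp add: r_def power_divide power_mult_distrib)
  obtain A where A: "A \<in> sets M" "prob A \<le> exp (- real n * r\<^sup>2 / 2)"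
    and A_le: "\<And>\<omega> u. \<omega> \<in> space M - A \<Longrightarrow> u \<in> unit_sphere n \<Longrightarrow>
      inner_tensor k n (G \<omega>) (tensor_power k u) \<le> sqrt (real n) * (mu k / sqrt (real k) + r)"
    using upper_tail_sphere[OF r v0] by blast
  let ?X0 = "\<lambda>\<omega>. inner_tensor k n (G \<omega>) (tensor_power k v\<^sub>0)"
  define A' where "A' = {\<omega> \<in> space M. ?X0 \<omega> < - (sqrt (real n) * r)}"
  have A': "A' \<in> sets M" unfolding A'_def by measurable
  have "prob A' \<le> exp (- (sqrt (real n) * r)\<^sup>2 / 2)"
    unfolding A'_def using r n by (intro lower_tail_fixed_vector v0) simp
  then have prob': "prob A' \<le> exp (- real n * r\<^sup>2 / 2)" by (simp add: power_mult_distrib)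
  let ?L = "{\<omega> \<in> space M. loss n (v_ML \<omega>) v\<^sub>0 \<le> 2 / \<beta> * (mu k + s)}"
  have "?L \<in> sets M"
    unfolding loss_def norm_vec_squared inner_vec_def using v_meas by measurable
  moreover have "space M - (A \<union> A') \<subseteq> ?L"
  proof
    fix \<omega> assume \<omega>: "\<omega> \<in> space M - (A \<union> A')"
    let ?Z = "\<lambda>u. inner_tensor k n (symmetric_noise k n (G \<omega>)) (tensor_power k u)"
    have v: "v_ML \<omega> \<in> unit_sphere n" and
      le: "loss n (v_ML \<omega>) v\<^sub>0 \<le> 2 / \<beta> * (?Z (v_ML \<omega>) - ?Z v\<^sub>0)"
      using loss_ML_le[OF v0 \<beta> est] \<omega> by auto
    have scale: "sqrt (real k / real n) * (sqrt (real n) * x) = sqrt (real k) * x" for x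
      using n by (simp add: real_sqrt_divide)
    have kr: "sqrt (real k) * r = s / 2" using k by (simp add: r_def)
    have "?Z (v_ML \<omega>) \<le> sqrt (real k / real n) * (sqrt (real n) * (mu k / sqrt (real k) + r))"
      unfolding inner_symmetric_noise using A_le[OF _ v] \<omega> by (intro mult_left_mono) auto
    also have "\<dots> = mu k + s / 2" unfolding scale using k kr by (simp add: distrib_left)
    finally have 1: "?Z (v_ML \<omega>) \<le> mu k + s / 2" .
    have "- (sqrt (real n) * r) \<le> ?X0 \<omega>" using \<omega> by (auto simp: A'_def)
    then have "sqrt (real k / real n) * - (sqrt (real n) * r) \<le> ?Z v\<^sub>0"
      unfolding inner_symmetric_noise by (rule mult_left_mono) simp
    then have 2: "- (s / 2) \<le> ?Z v\<^sub>0" using scale[of r] kr by simp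
    have "2 / \<beta> * (?Z (v_ML \<omega>) - ?Z v\<^sub>0) \<le> 2 / \<beta> * (mu k + s)"
      using 1 2 \<beta> by (intro mult_left_mono) auto
    with le \<omega> show "\<omega> \<in> ?L" by auto
  qed
  ultimately have "prob (space M - (A \<union> A')) \<le> prob ?L"
    by (intro finite_measure_mono) auto
  moreover have "prob (space M - (A \<union> A')) = 1 - prob (A \<union> A')"
    using A A' by (intro prob_compl) auto
  moreover have "prob (A \<union> A') \<le> prob A + prob A'"
    using A A' by (intro measure_Un_le) auto
  moreover have "real n * r\<^sup>2 / 2 = real n * s\<^sup>2 / (8 * real k)" by (simp add: r2)
  ultimately show ?thesis using A(2) prob' by simp
qed

end

theorem theorem2:
  fixes k :: nat
  assumes "k \<ge> 2"
  shows "\<forall>\<^sub>F n in sequentially.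
           \<forall>(M :: 'a measure) G v\<^sub>0 v_ML \<beta> s.
             prob_space M \<longrightarrow>
             iid_std_normal_tensor M k n G \<longrightarrow>
             v\<^sub>0 \<in> unit_sphere n \<longrightarrow>
             (\<forall>i<n. (\<lambda>\<omega>. v_ML \<omega> i) \<in> borel_measurable M) \<longrightarrow>
             (\<forall>\<omega>\<in>space M.
                is_ML_estimate k n (spiked_tensor k \<beta> v\<^sub>0 (symmetric_noise k n (G \<omega>))) (v_ML \<omega>)) \<longrightarrow>
             s > 0 \<longrightarrow>
             \<beta> \<ge> mu k \<longrightarrow>
             measure M {\<omega> \<in> space M. loss n (v_ML \<omega>) v\<^sub>0 \<le> 2 / \<beta> * (mu k + s)}
               \<ge> 1 - 2 * exp (- (real n * s\<^sup>2 / (16 * real k)))"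
proof (rule eventually_sequentiallyI[of 1], intro allI impI)
  fix n :: nat and M :: "'a measure" and G v\<^sub>0 v_ML and \<beta> s :: real
  assume n: "1 \<le> n" and M: "prob_space M" and iid: "iid_std_normal_tensor M k n G"
    and v0: "v\<^sub>0 \<in> unit_sphere n" and v_meas: "\<forall>i<n. (\<lambda>\<omega>. v_ML \<omega> i) \<in> borel_measurable M"
    and est: "\<forall>\<omega>\<in>space M. is_ML_estimate k n (spiked_tensor k \<beta> v\<^sub>0 (symmetric_noise k n (G \<omega>))) (v_ML \<omega>)"
    and s: "s > 0" and "\<beta> \<ge> mu k"
  then have \<beta>: "\<beta> > 0" using mu_pos[OF assms] by linarith
  \<comment> \<open>The rate obtained has 8 where the claim has 16, and it holds from
    \<open>n = 1\<close> on.\<close>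
  have "real n * s\<^sup>2 / (16 * real k) \<le> real n * s\<^sup>2 / (8 * real k)"
    using assms by (intro divide_left_mono) auto
  then have "1 - 2 * exp (- (real n * s\<^sup>2 / (16 * real k))) \<le> 1 - 2 * exp (- (real n * s\<^sup>2 / (8 * real k)))"
    by simp
  also have "\<dots> \<le> measure M {\<omega> \<in> space M. loss n (v_ML \<omega>) v\<^sub>0 \<le> 2 / \<beta> * (mu k + s)}"
    using v_meas est by (intro loss_ML_tail[OF M iid assms n v0 _ _ s \<beta>]) auto
  finally show "1 - 2 * exp (- (real n * s\<^sup>2 / (16 * real k)))
      \<le> measure M {\<omega> \<in> space M. loss n (v_ML \<omega>) v\<^sub>0 \<le> 2 / \<beta> * (mu k + s)}" .
qed

end
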